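(* Let $(S_n)$ be the elephant random walk with memory parameter $p$ in the diffusive regime $0\le p<3/4$ and first-step parameter $q\in[0,1]$. For any $0<\alpha<1$, the interval $$\mathcal{I}(p)=\Bigl[\widehat{p}_n-\frac{\sqrt{3-4\widehat{p}_n}}{2\sqrt{\log n}}\,t_{1-\alpha/2},\ \ \widehat{p}_n+\frac{\sqrt{3-4\widehat{p}_n}}{2\sqrt{\log n}}\,t_{1-\alpha/2}\Bigr]$$ is an asymptotic confidence interval for $p$ with confidence level $1-\alpha$, that is, $\lim_{n\to\infty}\mathbb{P}(p\in\mathcal{I}(p))=1-\alpha$, where $t_{1-\alpha/2}$ stands for the $(1-\alpha/2)$-quantile of the standard $\mathcal{N}(0,1)$ distribution.
   Context: Elephant random walk (ERW): fix $q\in[0,1]$ and $p\in[0,1]$. Set $S_0=0$. The first step $X_1$ equals $+1$ with probability $q$ and $-1$ with probability $1-q$. For each $n\ge 1$, an integer $k$ is chosen uniformly at random among $1,\dots,n$ (independently of the past), and $X_{n+1}=X_k$ with probability $p$, $X_{n+1}=-X_k$ with probability $1-p$. The position is $S_{n+1}=S_n+X_{n+1}$, so $S_n=X_1+\cdots+X_n$. Equivalently, with $\mathcal{F}_n=\sigma(X_1,\dots,X_n)$, $\mathbb{P}(X_{n+1}=1\mid\mathcal{F}_n)=\frac12\bigl(1+(2p-1)\frac{S_n}{n}\bigr)$ and $\mathbb{P}(X_{n+1}=-1\mid\mathcal{F}_n)=\frac12\bigl(1-(2p-1)\frac{S_n}{n}\bigr)$ for all $n\ge1$. Estimator: for all $n\ge2$,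 $$\widehat{p}_n=\frac{\sum_{k=1}^{n-1}\frac{S_k}{k}\bigl(X_{k+1}+\frac{S_k}{k}\bigr)}{2\sum_{k=1}^{n-1}\bigl(\frac{S_k}{k}\bigr)^2}.$$ *)

theory Defs
  imports "HOL-Probability.Probability"
begin

(* The steps are X 1, X 2, ...; the value X 0 plays no role.  At time n + 1 the walker
   recalls the step with index K n, and R n is the event that this step is repeated rather
   than reversed.  Only independence of (K n, R n) from X 1, ..., X n is required; no
   condition is imposed on the joint law of the pairs (K n, R n) for different n.
   Independence is stated for generated sigma-algebras because indep_var needs both
   variables to have the same value type. *)
locale elephant_random_walk = prob_space M
  for M :: "'a measure" +
  fixes p q :: real
    and X :: "nat \<Rightarrow> 'a \<Rightarrow> real"
    and K :: "nat \<Rightarrow> 'a \<Rightarrow> nat"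
    and R :: "nat \<Rightarrow> 'a \<Rightarrow> bool"
  assumes p_range: "0 \<le> p" "p \<le> 1"
    and q_range: "0 \<le> q" "q \<le> 1"
    and X_measurable: "\<And>n. 1 \<le> n \<Longrightarrow> random_variable borel (X n)"
    and K_measurable: "\<And>n. 1 \<le> n \<Longrightarrow> random_variable (count_space UNIV) (K n)"
    and R_measurable: "\<And>n. 1 \<le> n \<Longrightarrow> random_variable (count_space UNIV) (R n)"
    and first_step_pos: "prob {\<omega> \<in> space M. X 1 \<omega> = 1} = q"
    and first_step_neg: "prob {\<omega> \<in> space M. X 1 \<omega> = -1} = 1 - q"
    and choice_distr: "\<And>n. 1 \<le> n \<Longrightarrow>
      distr M (count_space UNIV) (\<lambda>\<omega>. (K n \<omega>, R n \<omega>)) =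
        measure_pmf (pair_pmf (pmf_of_set {1..n}) (bernoulli_pmf p))"
    and choice_indep: "\<And>n. 1 \<le> n \<Longrightarrow>
      indep_set
        (sets (vimage_algebra (space M) (\<lambda>\<omega>. \<lambda>k\<in>{1..n}. X k \<omega>) (PiM {1..n} (\<lambda>_. borel))))
        (sets (vimage_algebra (space M) (\<lambda>\<omega>. (K n \<omega>, R n \<omega>)) (count_space UNIV)))"
    and next_step: "\<And>n. 1 \<le> n \<Longrightarrow>
      AE \<omega> in M. X (Suc n) \<omega> = (if R n \<omega> then X (K n \<omega>) \<omega> else - X (K n \<omega>) \<omega>)"

definition erw_position :: "(nat \<Rightarrow> 'a \<Rightarrow> real) \<Rightarrow> nat \<Rightarrow> 'a \<Rightarrow> real" where
  "erw_position X n \<omega> = (\<Sum>k=1..n. X k \<omega>)"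

(* Only n \<ge> 2 is meaningful: the denominator is then almost surely at least 2, because
   the square of X 1 is 1. *)
definition erw_estimator :: "(nat \<Rightarrow> 'a \<Rightarrow> real) \<Rightarrow> nat \<Rightarrow> 'a \<Rightarrow> real" where
  "erw_estimator X n \<omega> =
    (\<Sum>k=1..n-1. erw_position X k \<omega> / real k * (X (k + 1) \<omega> + erw_position X k \<omega> / real k)) /
    (2 * (\<Sum>k=1..n-1. (erw_position X k \<omega> / real k)\<^sup>2))"

definition quantile :: "real measure \<Rightarrow> real \<Rightarrow> real" where
  "quantile N u = Inf {x. u \<le> cdf N x}"

definition erw_half_width :: "(nat \<Rightarrow> 'a \<Rightarrow> real) \<Rightarrow> real \<Rightarrow> nat \<Rightarrow> 'a \<Rightarrow> real" where
  "erw_half_width X \<alpha> n \<omega> =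
    sqrt (3 - 4 * erw_estimator X n \<omega>) / (2 * sqrt (ln (real n))) *
      quantile std_normal_distribution (1 - \<alpha> / 2)"

(* If the estimator exceeds 3/4, the square root has a negative argument.  Since
   sqrt (- x) = - sqrt x in the library, the half width is then negative (for n \<ge> 2 and
   0 < \<alpha> < 1) and the interval is empty. *)
definition erw_confidence_interval ::
    "(nat \<Rightarrow> 'a \<Rightarrow> real) \<Rightarrow> real \<Rightarrow> nat \<Rightarrow> 'a \<Rightarrow> real set" where
  "erw_confidence_interval X \<alpha> n \<omega> =
    {erw_estimator X n \<omega> - erw_half_width X \<alpha> n \<omega> ..
     erw_estimator X n \<omega> + erw_half_width X \<alpha> n \<omega>}"

end

theory Submission
  imports Defs
begin

text \<open>
  Put \<open>a = 2 p - 1 < 1/2\<close>, \<open>Z k = S k / k\<close>, \<open>D k = Z k * (X (k + 1) - a * Z k)\<close>, and let \<open>N n\<close> and \<open>V n\<close>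
  be the sums of \<open>D k\<close> and of \<open>(Z k)\<^sup>2\<close> over \<open>1 \<le> k < n\<close>. Then \<open>N\<close> is a martingale and the estimation
  error is \<open>N n / (2 V n)\<close>. The increments of \<open>Y k = (S k)\<^sup>2 / k\<close> express \<open>(1 - 2 a) (Z k)\<^sup>2\<close> as \<open>1 / k\<close>
  plus a martingale increment plus a telescoping term that stays bounded in mean. Summed up, this
  gives \<open>V n / ln n \<longrightarrow> 1 / (1 - 2 a)\<close> in probability. Inserted into the second order expansion of
  \<open>E (exp (i u N k))\<close>, where it replaces the random conditional variance by a deterministic one, it
  shows that \<open>E (exp (i u N n))\<close> is close to \<open>exp (- u\<^sup>2 harm n / (2 (1 - 2 a)))\<close>, so that Levy's
  continuity theorem yields the central limit theorem for \<open>N n / sqrt (ln n)\<close> without any general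
  martingale limit theorem. The two limits are combined as in Slutsky's lemma.
\<close>

section \<open>Bounded measurable functions\<close>

text \<open>Since \<open>E (X (k + 1) | F k) = a * Z k\<close>, the increment \<open>D k\<close> has
  conditional mean 0 and conditional variance \<open>(Z k)^2 - a^2 * (Z k)^4\<close>. This variance
  is random and in general correlated with \<open>N k\<close>; only its logarithmic average settles
  down. The expansion of \<open>phi\<close> therefore does not close: it produces the mixed
  expectation \<open>eta\<close> of \<open>(Z k)^2\<close> against the exponential. The drift of
  \<open>Y\<close>, tested against the same exponential, trades \<open>eta\<close> for
  \<open>phi / (k + 1)\<close> and a difference of \<open>gam\<close>, and absorbing that difference
  into the unknown leaves a scalar recursion with error of order
  \<open>|u|^3 / k + u^2 / k^2\<close> per step. For \<open>u\<close> of order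
  \<open>1 / sqrt (ln n)\<close> these errors add up to \<open>O(1 / sqrt (ln n))\<close>. All they
  require is \<open>E (S n)^2 = O(n)\<close> and \<open>E (S n)^4 = O(n^2)\<close>, which is where
  the diffusive regime is decisive. The model makes the steps 1 or -1 only almost surely. They are
  first replaced by an everywhere 1 or -1 version, so that all estimates before taking expectations
  are pointwise.\<close>

definition bdd_measurable :: "'a measure \<Rightarrow> ('a \<Rightarrow> 'b::{real_normed_field,banach,second_countable_topology}) \<Rightarrow> bool"
  where "bdd_measurable G f \<longleftrightarrow> f \<in> borel_measurable G \<and> (\<exists>B. \<forall>x. norm (f x) \<le> B)"

lemma bdd_measurableI:
  "f \<in> borel_measurable G \<Longrightarrow> (\<And>x. norm (f x) \<le> B) \<Longrightarrow> bdd_measurable G f"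
  by (auto simp: bdd_measurable_def)

lemma bdd_measurable_const: "bdd_measurable G (\<lambda>x. c)"
  by (rule bdd_measurableI[of _ _ "norm c"]) auto

lemma bdd_measurable_add:
  assumes "bdd_measurable G f" "bdd_measurable G g"
  shows "bdd_measurable G (\<lambda>x. f x + g x)"
proof -
  obtain B C where "\<And>x. norm (f x) \<le> B" "\<And>x. norm (g x) \<le> C"
    using assms by (auto simp: bdd_measurable_def)
  then have "norm (f x + g x) \<le> B + C" for x
    by (meson add_mono norm_triangle_ineq order_trans)
  with assms show ?thesis
    by (intro bdd_measurableI[of _ _ "B + C"]) (auto simp: bdd_measurable_def)
qed

lemma bdd_measurable_mult:
  assumes "bdd_measurable G f" "bdd_measurable G g"
  shows "bdd_measurable G (\<lambda>x. f x * g x)"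
proof -
  obtain B C where BC: "\<And>x. norm (f x) \<le> B" "\<And>x. norm (g x) \<le> C"
    using assms by (auto simp: bdd_measurable_def)
  have "norm (f x * g x) \<le> B * C" for x
    using BC[of x] by (simp add: norm_mult mult_mono' )
  with assms show ?thesis
    by (intro bdd_measurableI[of _ _ "B * C"]) (auto simp: bdd_measurable_def)
qed

lemma bdd_measurable_uminus: "bdd_measurable G f \<Longrightarrow> bdd_measurable G (\<lambda>x. - f x)"
  using bdd_measurable_mult[OF bdd_measurable_const[of G "-1"], of f] by simp

lemma bdd_measurable_diff:
  "bdd_measurable G f \<Longrightarrow> bdd_measurable G g \<Longrightarrow> bdd_measurable G (\<lambda>x. f x - g x)"
  using bdd_measurable_add[of G f "\<lambda>x. - g x"] bdd_measurable_uminus[of G g] by simp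

lemma bdd_measurable_divide: "bdd_measurable G f \<Longrightarrow> bdd_measurable G (\<lambda>x. f x / c)"
  using bdd_measurable_mult[OF _ bdd_measurable_const[of G "inverse c"], of f] by (simp add: divide_inverse)

lemma bdd_measurable_power: "bdd_measurable G f \<Longrightarrow> bdd_measurable G (\<lambda>x. f x ^ m)"
  by (induction m) (auto intro: bdd_measurable_const bdd_measurable_mult)

lemma bdd_measurable_sum:
  "(\<And>i. i \<in> I \<Longrightarrow> bdd_measurable G (f i)) \<Longrightarrow> bdd_measurable G (\<lambda>x. \<Sum>i\<in>I. f i x)"
  by (induction I rule: infinite_finite_induct)
    (auto intro: bdd_measurable_const bdd_measurable_add)

lemma bdd_measurable_of_real:
  fixes f :: "'a \<Rightarrow> real"
  shows "bdd_measurable G f \<Longrightarrow> bdd_measurable G (\<lambda>x. complex_of_real (f x))"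
  by (auto simp: bdd_measurable_def)

lemma bdd_measurable_norm: "bdd_measurable G f \<Longrightarrow> bdd_measurable G (\<lambda>x. norm (f x))"
  by (auto simp: bdd_measurable_def)

lemma bdd_measurable_abs:
  fixes f :: "'a \<Rightarrow> real"
  shows "bdd_measurable G f \<Longrightarrow> bdd_measurable G (\<lambda>x. \<bar>f x\<bar>)"
  using bdd_measurable_norm[of G f] by simp

lemma bdd_measurable_Re: "bdd_measurable G f \<Longrightarrow> bdd_measurable G (\<lambda>x. Re (f x))"
  by (auto simp: bdd_measurable_def intro: order_trans[OF abs_Re_le_cmod])

lemma bdd_measurable_Im: "bdd_measurable G f \<Longrightarrow> bdd_measurable G (\<lambda>x. Im (f x))"
  by (auto simp: bdd_measurable_def intro: order_trans[OF abs_Im_le_cmod])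

lemma bdd_measurable_iexp:
  fixes f :: "'a \<Rightarrow> real"
  assumes "bdd_measurable G f"
  shows "bdd_measurable G (\<lambda>x. iexp (f x))"
  using assms by (intro bdd_measurableI[of _ _ 1]) (auto simp: bdd_measurable_def)

lemmas bdd_measurable_intros =
  bdd_measurable_const bdd_measurable_add bdd_measurable_mult bdd_measurable_uminus
  bdd_measurable_diff bdd_measurable_divide bdd_measurable_power bdd_measurable_sum
  bdd_measurable_of_real bdd_measurable_norm bdd_measurable_abs bdd_measurable_iexp
  bdd_measurable_Re bdd_measurable_Im

lemma bdd_measurable_subalgebra:
  "subalgebra M G \<Longrightarrow> bdd_measurable G f \<Longrightarrow> bdd_measurable M f"
  by (auto simp: bdd_measurable_def intro: measurable_from_subalg)

lemma (in finite_measure) bdd_measurable_integrable: "bdd_measurable M f \<Longrightarrow> integrable M f"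
  by (auto simp: bdd_measurable_def intro: integrable_const_bound)

lemma sum_inverse_squares_le: "(\<Sum>k=1..<n. 1 / (real k)\<^sup>2) \<le> 2"
proof -
  \<comment> \<open>The bound 2 alone is not inductive; \<open>2 - 1 / n\<close> is, because
    \<open>1 / (n + 1)^2\<close> is at most \<open>1 / n - 1 / (n + 1)\<close>.\<close>
  have "n \<ge> 1 \<Longrightarrow> (\<Sum>k=1..n. 1 / (real k)\<^sup>2) \<le> 2 - 1 / real n" for n
  proof (induction n rule: nat_induct_at_least)
    case (Suc n)
    have "1 / (real (Suc n))\<^sup>2 \<le> 1 / (real n * real (Suc n))"
      using Suc by (intro divide_left_mono mult_pos_pos) (auto simp: power2_eq_square intro!: mult_right_mono)
    also have "\<dots> = 1 / real n - 1 / real (Suc n)"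
      using Suc by (simp add: field_simps)
    finally show ?case using Suc by simp
  qed simp
  note le = this
  show ?thesis
  proof (cases "n \<ge> 2")
    case True
    have eq: "{1..<n} = {1..n-1}" using True by auto
    show ?thesis unfolding eq
      using True by (intro order_trans[OF le]) auto
  next
    case False
    then have "{1..<n} = {}" by auto
    then show ?thesis by (simp only: sum.empty)
  qed
qed

section \<open>The martingale of the elephant random walk\<close>

text \<open>\<open>next_step_mean\<close> is \<open>E (X (n + 1) | F n) = a * S n / n\<close>,
  tested against bounded functions so that conditional expectations never appear.
  \<open>X_cases\<close> holds at every point, in line with the bound in
  \<open>bdd_measurable\<close>, which ranges over the whole type.\<close>

locale erw_martingale = prob_space M
  for M :: "'a measure" +
  fixes F :: "nat \<Rightarrow> 'a measure" and X :: "nat \<Rightarrow> 'a \<Rightarrow> real" and a :: real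
  assumes a_ge: "-1 \<le> a" and a_less: "a < 1 / 2"
    and subalg: "\<And>n. subalgebra M (F n)"
    and X_adapted: "\<And>k n. 1 \<le> k \<Longrightarrow> k \<le> n \<Longrightarrow> X k \<in> borel_measurable (F n)"
    and X_cases: "\<And>k \<omega>. X k \<omega> = 1 \<or> X k \<omega> = -1"
    and next_step_mean: "\<And>n g. 1 \<le> n \<Longrightarrow> bdd_measurable (F n) g \<Longrightarrow>
      expectation (\<lambda>\<omega>. g \<omega> * X (Suc n) \<omega>) =
        a * expectation (\<lambda>\<omega>. g \<omega> * (erw_position X n \<omega> / real n))"
begin

abbreviation S :: "nat \<Rightarrow> 'a \<Rightarrow> real" where "S \<equiv> erw_position X"

definition Z :: "nat \<Rightarrow> 'a \<Rightarrow> real" where "Z n \<omega> = S n \<omega> / real n"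
definition D :: "nat \<Rightarrow> 'a \<Rightarrow> real" where "D n \<omega> = Z n \<omega> * (X (Suc n) \<omega> - a * Z n \<omega>)"
definition N :: "nat \<Rightarrow> 'a \<Rightarrow> real" where "N n \<omega> = (\<Sum>k=1..<n. D k \<omega>)"
definition V :: "nat \<Rightarrow> 'a \<Rightarrow> real" where "V n \<omega> = (\<Sum>k=1..<n. (Z k \<omega>)\<^sup>2)"
text \<open>The fixed point of \<open>C = 1 + 2 * max a 0 * C\<close>, which is what the induction
  for the second moment demands. It is positive because \<open>a < 1/2\<close>; the maximum with 0
  covers negative \<open>a\<close>.\<close>

definition C :: real where "C = 1 / (1 - 2 * max a 0)"

lemma X_abs [simp]: "\<bar>X k \<omega>\<bar> = 1" and X_sq [simp]: "(X k \<omega>)\<^sup>2 = 1"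
  using X_cases[of k \<omega>] by auto

lemma abs_a_le: "\<bar>a\<bar> \<le> 1" using a_ge a_less by auto

lemma C_ge_1: "1 \<le> C" using a_less by (simp add: C_def)
lemma C_pos: "0 < C" using C_ge_1 by simp

lemma S_Suc: "S (Suc n) \<omega> = S n \<omega> + X (Suc n) \<omega>"
  by (simp add: erw_position_def)

lemma abs_S_le: "\<bar>S n \<omega>\<bar> \<le> real n"
  unfolding erw_position_def by (rule order_trans[OF sum_abs]) simp

lemma abs_Z_le: "\<bar>Z n \<omega>\<bar> \<le> 1"
  using abs_S_le[of n \<omega>] by (cases "n = 0") (auto simp: Z_def field_simps)

lemma abs_eps_le: "\<bar>X (Suc n) \<omega> - a * Z n \<omega>\<bar> \<le> 2"
proof -
  have "\<bar>a * Z n \<omega>\<bar> \<le> 1 * 1" unfolding abs_mult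
    by (intro mult_mono abs_a_le abs_Z_le) auto
  with X_abs[of "Suc n" \<omega>] show ?thesis by linarith
qed

lemma abs_D_le: "\<bar>D n \<omega>\<bar> \<le> 2 * \<bar>Z n \<omega>\<bar>"
  unfolding D_def abs_mult using mult_left_mono[OF abs_eps_le[of n \<omega>] abs_ge_zero[of "Z n \<omega>"]]
  by (simp add: mult.commute)

text \<open>Because the square of a step is 1, the next step enters only linearly, so
  \<open>next_step_mean\<close> suffices to evaluate expectations of the square.\<close>

lemma D_sq: "(D n \<omega>)\<^sup>2 = (Z n \<omega>)\<^sup>2 + (Z n \<omega>)^4 * a\<^sup>2 - 2 * a * ((Z n \<omega>)^3 * X (Suc n) \<omega>)"
proof -
  have "(D n \<omega>)\<^sup>2 = (Z n \<omega>)\<^sup>2 * (X (Suc n) \<omega>)\<^sup>2 + (Z n \<omega>)^4 * a\<^sup>2 - 2 * a * ((Z n \<omega>)^3 * X (Suc n) \<omega>)"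
    by (simp only: D_def) (simp add: algebra_simps eval_nat_numeral)
  then show ?thesis by simp
qed

lemma D_sq_le: "(D n \<omega>)\<^sup>2 \<le> 4 * (Z n \<omega>)\<^sup>2"
  using power_mono[OF abs_D_le[of n \<omega>] abs_ge_zero, of 2] by (simp add: power_mult_distrib)

lemma N_Suc: "1 \<le> n \<Longrightarrow> N (Suc n) \<omega> = N n \<omega> + D n \<omega>"
  by (simp add: N_def)

lemma V_Suc: "1 \<le> n \<Longrightarrow> V (Suc n) \<omega> = V n \<omega> + (Z n \<omega>)\<^sup>2"
  by (simp add: V_def)

lemma bdd_X: "1 \<le> k \<Longrightarrow> k \<le> n \<Longrightarrow> bdd_measurable (F n) (X k)"
  by (rule bdd_measurableI[of _ _ 1]) (auto intro: X_adapted)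

lemma bdd_S: "k \<le> n \<Longrightarrow> bdd_measurable (F n) (S k)"
  unfolding erw_position_def [abs_def] by (intro bdd_measurable_sum bdd_X) auto

lemma bdd_Z: "k \<le> n \<Longrightarrow> bdd_measurable (F n) (Z k)"
  unfolding Z_def[abs_def] by (intro bdd_measurable_intros bdd_S)

lemma bdd_D: "k < n \<Longrightarrow> bdd_measurable (F n) (D k)"
  unfolding D_def[abs_def] by (intro bdd_measurable_intros bdd_Z bdd_X) auto

lemma bdd_N: "bdd_measurable (F n) (N n)"
  unfolding N_def[abs_def] by (intro bdd_measurable_intros bdd_D) auto

lemma bdd_V: "bdd_measurable (F n) (V n)"
  unfolding V_def[abs_def] by (intro bdd_measurable_intros bdd_Z) auto

lemma bdd_M: "bdd_measurable (F n) f \<Longrightarrow> bdd_measurable M f"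
  using bdd_measurable_subalgebra subalg by blast

lemma bdd_X_Suc: "bdd_measurable M (X (Suc k))"
  by (rule bdd_M[OF bdd_X[of "Suc k" "Suc k"]]) auto

lemmas bdd_intros = bdd_measurable_intros
  bdd_X_Suc bdd_M[OF bdd_S[OF order_refl]] bdd_M[OF bdd_Z[OF order_refl]]
  bdd_M[OF bdd_D[OF lessI]] bdd_M[OF bdd_N] bdd_M[OF bdd_V]

lemmas int_intros = bdd_measurable_integrable bdd_intros

lemma next_step_mean_complex:
  assumes "1 \<le> n" "bdd_measurable (F n) g"
  shows "(CLINT \<omega>|M. g \<omega> * complex_of_real (X (Suc n) \<omega>)) =
    complex_of_real a * (CLINT \<omega>|M. g \<omega> * complex_of_real (Z n \<omega>))"
    (is "?l = complex_of_real a * ?r")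
proof -
  have g: "bdd_measurable M g" by (rule bdd_M) fact
  have i1: "integrable M (\<lambda>\<omega>. g \<omega> * complex_of_real (X (Suc n) \<omega>))"
    and i2: "integrable M (\<lambda>\<omega>. g \<omega> * complex_of_real (Z n \<omega>))"
    by (intro int_intros g; simp)+
  have "Re ?l = a * Re ?r"
    using next_step_mean[OF assms(1), of "\<lambda>\<omega>. Re (g \<omega>)"] assms(2)
    by (simp flip: integral_Re Z_def add: i1 i2 bdd_measurable_Re)
  moreover have "Im ?l = a * Im ?r"
    using next_step_mean[OF assms(1), of "\<lambda>\<omega>. Im (g \<omega>)"] assms(2)
    by (simp flip: integral_Im Z_def add: i1 i2 bdd_measurable_Im)
  ultimately show ?thesis by (simp add: complex_eq_iff)
qed

lemma D_mean_complex:
  assumes "1 \<le> n" "bdd_measurable (F n) g"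
  shows "(CLINT \<omega>|M. g \<omega> * complex_of_real (D n \<omega>)) = 0"
proof -
  let ?h = "\<lambda>\<omega>. g \<omega> * complex_of_real (Z n \<omega>)"
  have g: "bdd_measurable M g" by (rule bdd_M) fact
  have h: "bdd_measurable (F n) ?h"
    by (intro bdd_measurable_intros bdd_Z assms order_refl)
  have "(CLINT \<omega>|M. g \<omega> * complex_of_real (D n \<omega>)) =
     (CLINT \<omega>|M. ?h \<omega> * complex_of_real (X (Suc n) \<omega>) - complex_of_real a * (?h \<omega> * complex_of_real (Z n \<omega>)))"
    by (rule Bochner_Integration.integral_cong) (auto simp: D_def algebra_simps)
  also have "\<dots> = (CLINT \<omega>|M. ?h \<omega> * complex_of_real (X (Suc n) \<omega>)) -
     complex_of_real a * (CLINT \<omega>|M. ?h \<omega> * complex_of_real (Z n \<omega>))"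
    by (subst Bochner_Integration.integral_diff) (intro int_intros g; simp | simp)+
  finally show ?thesis using next_step_mean_complex[OF assms(1) h] by simp
qed

lemma D_mean:
  fixes g :: "'a \<Rightarrow> real"
  assumes "1 \<le> n" "bdd_measurable (F n) g"
  shows "expectation (\<lambda>\<omega>. g \<omega> * D n \<omega>) = 0"
  using D_mean_complex[OF assms(1) bdd_measurable_of_real[OF assms(2)]]
  by (simp flip: of_real_mult)

section \<open>Second and fourth moments of the walk\<close>

lemma S1_sq: "(S (Suc 0) \<omega>)\<^sup>2 = 1"
  by (simp add: erw_position_def)

lemma S_sq_Suc_le:
  assumes "1 \<le> n"
  shows "expectation (\<lambda>\<omega>. (S (Suc n) \<omega>)\<^sup>2) \<le>
    (1 + 2 * max a 0 / real n) * expectation (\<lambda>\<omega>. (S n \<omega>)\<^sup>2) + 1"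
proof -
  have "expectation (\<lambda>\<omega>. (S (Suc n) \<omega>)\<^sup>2) =
      expectation (\<lambda>\<omega>. (S n \<omega>)\<^sup>2 + 2 * (S n \<omega> * X (Suc n) \<omega>) + 1)"
    by (rule Bochner_Integration.integral_cong) (auto simp: S_Suc power2_sum)
  also have "\<dots> = expectation (\<lambda>\<omega>. (S n \<omega>)\<^sup>2) + 2 * expectation (\<lambda>\<omega>. S n \<omega> * X (Suc n) \<omega>) + 1"
    by (subst Bochner_Integration.integral_add, (intro int_intros; simp)+)+ (simp add: prob_space)
  also have "expectation (\<lambda>\<omega>. S n \<omega> * X (Suc n) \<omega>) = a / real n * expectation (\<lambda>\<omega>. (S n \<omega>)\<^sup>2)"
    by (subst next_step_mean) (use assms in \<open>auto intro: bdd_S simp: power2_eq_square\<close>)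
  also have "a / real n * expectation (\<lambda>\<omega>. (S n \<omega>)\<^sup>2) \<le> max a 0 / real n * expectation (\<lambda>\<omega>. (S n \<omega>)\<^sup>2)"
    by (intro mult_right_mono divide_right_mono) auto
  finally show ?thesis by (simp add: algebra_simps)
qed

text \<open>The factors \<open>1 + 2 b / n\<close> with \<open>b = max a 0\<close> alone produce
  growth of order \<open>n\<close> to the power \<open>2 b\<close>, slower than \<open>n\<close> as
  \<open>b < 1/2\<close>. The additive 1 thus determines the linear order.\<close>

lemma S_sq_le: "1 \<le> n \<Longrightarrow> expectation (\<lambda>\<omega>. (S n \<omega>)\<^sup>2) \<le> C * real n"
proof (induction n rule: nat_induct_at_least)
  case base
  show ?case using C_ge_1 by (simp add: S1_sq prob_space)
next
  case (Suc n)
  let ?b = "max a 0"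
  have "expectation (\<lambda>\<omega>. (S (Suc n) \<omega>)\<^sup>2) \<le> (1 + 2 * ?b / real n) * expectation (\<lambda>\<omega>. (S n \<omega>)\<^sup>2) + 1"
    by (rule S_sq_Suc_le) fact
  also have "\<dots> \<le> (1 + 2 * ?b / real n) * (C * real n) + 1"
    using Suc by (intro add_mono mult_left_mono) auto
  also have "\<dots> = C * real n + (2 * ?b * C + 1)"
    using Suc by (simp add: field_simps)
  also have "2 * ?b * C + 1 = C"
    unfolding C_def using a_less by (simp add: field_simps)
  finally show ?case by (simp add: algebra_simps)
qed

lemma S_pow4_Suc_le:
  assumes "1 \<le> n"
  shows "expectation (\<lambda>\<omega>. (S (Suc n) \<omega>)^4) \<le>
    (1 + 4 * max a 0 / real n) * expectation (\<lambda>\<omega>. (S n \<omega>)^4) + 10 * expectation (\<lambda>\<omega>. (S n \<omega>)\<^sup>2) + 1"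
proof -
  let ?S = "S n" and ?X = "X (Suc n)"
  have "(s + x) ^ 4 = s^4 + 4 * (s^3 * x) + 6 * s\<^sup>2 + 4 * (s * x) + 1" if "x\<^sup>2 = 1" for s x :: real
  proof -
    have "(s + x) ^ 4 = s^4 + 4 * (s^3 * x) + 6 * s\<^sup>2 * x\<^sup>2 + 4 * (s * x) * x\<^sup>2 + x\<^sup>2 * x\<^sup>2"
      by (simp add: algebra_simps eval_nat_numeral)
    then show ?thesis by (simp add: that)
  qed
  then have "expectation (\<lambda>\<omega>. (S (Suc n) \<omega>)^4) =
      expectation (\<lambda>\<omega>. (?S \<omega>)^4 + 4 * ((?S \<omega>)^3 * ?X \<omega>) + 6 * (?S \<omega>)\<^sup>2 + 4 * (?S \<omega> * ?X \<omega>) + 1)"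
    by (intro Bochner_Integration.integral_cong) (auto simp: S_Suc)
  also have "\<dots> = expectation (\<lambda>\<omega>. (?S \<omega>)^4) + 4 * expectation (\<lambda>\<omega>. (?S \<omega>)^3 * ?X \<omega>) +
      6 * expectation (\<lambda>\<omega>. (?S \<omega>)\<^sup>2) + 4 * expectation (\<lambda>\<omega>. ?S \<omega> * ?X \<omega>) + 1"
    by (subst Bochner_Integration.integral_add, (intro int_intros; simp)+)+ (simp add: prob_space)
  also have "expectation (\<lambda>\<omega>. ?S \<omega> * ?X \<omega>) = a / real n * expectation (\<lambda>\<omega>. (?S \<omega>)\<^sup>2)"
    by (subst next_step_mean) (use assms in \<open>auto intro: bdd_S simp: power2_eq_square\<close>)
  also have "expectation (\<lambda>\<omega>. (?S \<omega>)^3 * ?X \<omega>) = a / real n * expectation (\<lambda>\<omega>. (?S \<omega>)^4)"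
    by (subst next_step_mean, fact, intro bdd_measurable_power bdd_S order_refl)
      (simp add: eval_nat_numeral mult_ac)
  also have "a / real n * expectation (\<lambda>\<omega>. (?S \<omega>)^4) \<le> max a 0 / real n * expectation (\<lambda>\<omega>. (?S \<omega>)^4)"
    by (intro mult_right_mono divide_right_mono) auto
  \<comment> \<open>This term is of lower order than the fourth moment, so the crude bound
    \<open>a / n \<le> 1\<close> is enough; 4 times it joins the 6 to give the coefficient
    10.\<close>
  also have "a / real n * expectation (\<lambda>\<omega>. (?S \<omega>)\<^sup>2) \<le> 1 * expectation (\<lambda>\<omega>. (?S \<omega>)\<^sup>2)"
    using assms a_less by (intro mult_right_mono) (auto simp: field_simps)
  finally show ?thesis by (simp add: algebra_simps)
qed

text \<open>With \<open>2 b C = C - 1\<close> the linear terms of the recursion collapse to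
  \<open>10 * C^2 * n\<close>. The factor 5 is chosen so that this is exactly the cross term of
  \<open>5 * C^2 * (n + 1)^2\<close>.\<close>

lemma S_pow4_le: "1 \<le> n \<Longrightarrow> expectation (\<lambda>\<omega>. (S n \<omega>)^4) \<le> 5 * C\<^sup>2 * (real n)\<^sup>2"
proof (induction n rule: nat_induct_at_least)
  case base
  have "(S 1 \<omega>)^4 = 1" for \<omega>
    using S1_sq[of \<omega>] by (metis One_nat_def power2_eq_square power4_eq_xxxx mult.assoc mult_1)
  then show ?case using power_mono[OF C_ge_1, of 2] by (simp add: prob_space)
next
  case (Suc n)
  let ?b = "max a 0"
  have Cb: "2 * ?b * C = C - 1"
    unfolding C_def using a_less by (simp add: field_simps)
  have "expectation (\<lambda>\<omega>. (S (Suc n) \<omega>)^4) \<le> (1 + 4 * ?b / real n) * expectation (\<lambda>\<omega>. (S n \<omega>)^4) +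
     10 * expectation (\<lambda>\<omega>. (S n \<omega>)\<^sup>2) + 1"
    by (rule S_pow4_Suc_le) fact
  also have "\<dots> \<le> (1 + 4 * ?b / real n) * (5 * C\<^sup>2 * (real n)\<^sup>2) + 10 * (C * real n) + 1"
    using Suc S_sq_le[of n] by (intro add_mono mult_left_mono) auto
  also have "\<dots> = 5 * C\<^sup>2 * (real n)\<^sup>2 + 10 * (2 * ?b * C) * C * real n + 10 * C * real n + 1"
    using Suc by (simp add: field_simps power2_eq_square)
  also have "\<dots> = 5 * C\<^sup>2 * ((real n)\<^sup>2 + 2 * real n) + 1"
    unfolding Cb by (simp add: algebra_simps power2_eq_square)
  also have "\<dots> \<le> 5 * C\<^sup>2 * ((real n)\<^sup>2 + 2 * real n) + 5 * C\<^sup>2"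
    using power_mono[OF C_ge_1, of 2] by simp
  also have "\<dots> = 5 * C\<^sup>2 * (real (Suc n))\<^sup>2"
    by (simp add: algebra_simps power2_eq_square)
  finally show ?case .
qed

lemma Z_sq_le: "1 \<le> n \<Longrightarrow> expectation (\<lambda>\<omega>. (Z n \<omega>)\<^sup>2) \<le> C / real n"
  using S_sq_le[of n] by (simp add: Z_def power_divide field_simps power2_eq_square)

lemma Z_pow4_le: "1 \<le> n \<Longrightarrow> expectation (\<lambda>\<omega>. (Z n \<omega>)^4) \<le> 5 * C\<^sup>2 / (real n)\<^sup>2"
  using S_pow4_le[of n] by (simp add: Z_def power_divide field_simps eval_nat_numeral)


text \<open>Martingale increments are orthogonal, so the second moments of the \<open>D k\<close>
  simply add up, each at most \<open>4 * C / k\<close>. The shift to \<open>Suc n\<close> reflects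
  that \<open>N n\<close> stops at \<open>D (n - 1)\<close>.\<close>

lemma N_sq_le: "expectation (\<lambda>\<omega>. (N (Suc n) \<omega>)\<^sup>2) \<le> 4 * C * harm n"
proof (induction n)
  case 0
  show ?case using C_pos by (simp add: N_def harm_expand)
next
  case (Suc m)
  define n where "n = Suc m"
  have n: "1 \<le> n" by (simp add: n_def)
  have "expectation (\<lambda>\<omega>. (N (Suc n) \<omega>)\<^sup>2) =
      expectation (\<lambda>\<omega>. (N n \<omega>)\<^sup>2 + 2 * (N n \<omega> * D n \<omega>) + (D n \<omega>)\<^sup>2)"
    using n by (intro Bochner_Integration.integral_cong) (auto simp: N_Suc power2_sum)
  also have "\<dots> = expectation (\<lambda>\<omega>. (N n \<omega>)\<^sup>2) + 2 * expectation (\<lambda>\<omega>. N n \<omega> * D n \<omega>) + expectation (\<lambda>\<omega>. (D n \<omega>)\<^sup>2)"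
    by (subst Bochner_Integration.integral_add, (intro int_intros; simp)+)+ simp
  also have "expectation (\<lambda>\<omega>. N n \<omega> * D n \<omega>) = 0"
    using n bdd_N by (intro D_mean) auto
  finally have "expectation (\<lambda>\<omega>. (N (Suc n) \<omega>)\<^sup>2) = expectation (\<lambda>\<omega>. (N n \<omega>)\<^sup>2) + expectation (\<lambda>\<omega>. (D n \<omega>)\<^sup>2)"
    by simp
  moreover have "expectation (\<lambda>\<omega>. (D n \<omega>)\<^sup>2) \<le> expectation (\<lambda>\<omega>. 4 * (Z n \<omega>)\<^sup>2)"
    by (intro integral_mono int_intros D_sq_le)
  moreover have "expectation (\<lambda>\<omega>. 4 * (Z n \<omega>)\<^sup>2) \<le> 4 * (C / real n)"
    using Z_sq_le[of n] n by simp
  moreover have "4 * C * harm n = 4 * C * harm m + 4 * (C / real n)"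
    unfolding n_def harm_Suc by (simp add: field_simps)
  ultimately show ?case
    using Suc unfolding n_def by linarith
qed

end

section \<open>The characteristic function of the martingale\<close>

lemma iexp_minus_1_le: "cmod (iexp x - 1) \<le> \<bar>x\<bar>"
  using iexp_approx1[of x 0] by simp

lemma iexp_order1_le: "cmod (iexp x - 1 - \<i> * of_real x) \<le> x\<^sup>2 / 2"
  using iexp_approx1[of x 1] by (simp add: diff_diff_eq numeral_2_eq_2)

lemma iexp_order2_le: "cmod (iexp x - 1 - \<i> * of_real x + (of_real x)\<^sup>2 / 2) \<le> \<bar>x\<bar>^3 / 6"
proof -
  have "iexp x - (\<Sum>k\<le>2. (\<i> * of_real x)^k / fact k) = iexp x - 1 - \<i> * of_real x + (of_real x)\<^sup>2 / 2"
    by (simp add: numeral_2_eq_2 power_mult_distrib)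
  moreover have "cmod (iexp x - (\<Sum>k\<le>2. (\<i> * of_real x)^k / fact k)) \<le> \<bar>x\<bar>^3 / 6"
    using iexp_approx1[of x 2] by (simp add: eval_nat_numeral)
  ultimately show ?thesis by (simp only:)
qed

lemma abs_exp_minus_le:
  fixes x :: real
  assumes "0 \<le> x"
  shows "\<bar>exp (- x) - (1 - x)\<bar> \<le> x\<^sup>2 / 2"
proof -
  let ?f = "\<lambda>x::real. 1 - x + x\<^sup>2 / 2 - exp (- x)"
  have "?f 0 \<le> ?f x"
  proof (rule DERIV_nonneg_imp_nondecreasing[OF assms])
    fix y :: real assume "0 \<le> y" "y \<le> x"
    show "\<exists>z. (?f has_real_derivative z) (at y) \<and> 0 \<le> z"
      using exp_ge_add_one_self[of "- y"]
      by (intro exI[of _ "- 1 + y + exp (- y)"] conjI) (auto intro!: derivative_eq_intros)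
  qed
  then show ?thesis using exp_ge_add_one_self[of "- x"] by simp
qed

context erw_martingale
begin

definition Y :: "nat \<Rightarrow> 'a \<Rightarrow> real" where "Y k \<omega> = real k * (Z k \<omega>)\<^sup>2"

definition phi :: "real \<Rightarrow> nat \<Rightarrow> complex" where
  "phi u k = (CLINT \<omega>|M. iexp (u * N k \<omega>))"

definition gam :: "real \<Rightarrow> nat \<Rightarrow> complex" where
  "gam u k = (CLINT \<omega>|M. iexp (u * N k \<omega>) * complex_of_real (Y k \<omega>))"

text \<open>The quantity through which the random conditional variance enters the expansion of
  \<open>phi\<close>. It cannot be factored; \<open>gam\<close> is introduced because its
  differences determine \<open>eta\<close> up to small errors.\<close>

definition eta :: "real \<Rightarrow> nat \<Rightarrow> complex" where
  "eta u k = (CLINT \<omega>|M. iexp (u * N k \<omega>) * complex_of_real ((Z k \<omega>)\<^sup>2))"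

lemma bdd_Y: "bdd_measurable (F n) (Y n)"
  unfolding Y_def[abs_def] by (intro bdd_measurable_intros bdd_Z order_refl)

lemma bdd_iexp: "bdd_measurable (F n) (\<lambda>\<omega>. iexp (u * N n \<omega>))"
  by (intro bdd_measurable_intros bdd_N)

lemma iexp_N_Suc: "1 \<le> k \<Longrightarrow> iexp (u * N (Suc k) \<omega>) = iexp (u * N k \<omega>) * iexp (u * D k \<omega>)"
  by (simp add: N_Suc distrib_left flip: exp_add)

lemmas int_intros' = int_intros bdd_M[OF bdd_Y]

text \<open>Linearity in introduction form: the integral of a linear combination is read off term by
  term, with integrability appearing as side goals settled by boundedness.\<close>

lemmas expectation_intros = has_bochner_integral_integral_eq has_bochner_integral_add has_bochner_integral_diff
  has_bochner_integral_mult_right has_bochner_integral_integrable int_intros'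

lemma norm_expectation_le:
  fixes f :: "'a \<Rightarrow> complex"
  assumes "bdd_measurable M f" "bdd_measurable M g" "\<And>\<omega>. cmod (f \<omega>) \<le> g \<omega>"
  shows "cmod (CLINT \<omega>|M. f \<omega>) \<le> expectation g"
  using assms by (intro order_trans[OF integral_norm_bound] integral_mono bdd_measurable_integrable bdd_measurable_norm)

text \<open>Second order Taylor expansion of \<open>iexp (u * D k)\<close>. The linear term vanishes
  by the martingale property and the square contributes \<open>(Z k)^2 - a^2 * (Z k)^4\<close>. The
  fourth power costs \<open>1 / k^2\<close> and the cubic remainder \<open>|u|^3 / k\<close> in
  mean.\<close>

lemma phi_Suc_approx:
  assumes "1 \<le> k"
  shows "cmod (phi u (Suc k) - phi u k + (of_real u)\<^sup>2 / 2 * eta u k)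
    \<le> 3 * C\<^sup>2 * (\<bar>u\<bar>^3 / real k + u\<^sup>2 / (real k)\<^sup>2)"
proof -
  let ?e = "\<lambda>\<omega>. iexp (u * N k \<omega>)"
  let ?r = "\<lambda>\<omega>. iexp (u * D k \<omega>) - 1 - \<i> * of_real (u * D k \<omega>) + (of_real (u * D k \<omega>))\<^sup>2 / 2"
  let ?z4 = "CLINT \<omega>|M. ?e \<omega> * complex_of_real ((Z k \<omega>)^4)"
  have id1: "P - p + v * h = v * b\<^sup>2 * z + R"
    if "P = p + w * 0 - v * (h + b\<^sup>2 * z - 2 * b * (b * z)) + R" for P p v h b z R w :: complex
    unfolding that by (simp add: algebra_simps power2_eq_square)
  have "phi u (Suc k) = (CLINT \<omega>|M. ?e \<omega> + (\<i> * of_real u) * (?e \<omega> * complex_of_real (D k \<omega>))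
      - (of_real u)\<^sup>2 / 2 * (?e \<omega> * complex_of_real ((D k \<omega>)\<^sup>2)) + ?e \<omega> * ?r \<omega>)"
    unfolding phi_def iexp_N_Suc[OF assms]
  proof (intro Bochner_Integration.integral_cong refl)
    fix \<omega>
    have "e * x = e + (\<i> * v) * (e * d) - v\<^sup>2 / 2 * (e * d\<^sup>2) + e * (x - 1 - \<i> * (v * d) + (v * d)\<^sup>2 / 2)"
      for e x v d :: complex
      by (simp add: algebra_simps power2_eq_square)
    from this[of "?e \<omega>" "iexp (u * D k \<omega>)" "of_real u" "of_real (D k \<omega>)"]
    show "?e \<omega> * iexp (u * D k \<omega>) = ?e \<omega> + (\<i> * of_real u) * (?e \<omega> * complex_of_real (D k \<omega>))
      - (of_real u)\<^sup>2 / 2 * (?e \<omega> * complex_of_real ((D k \<omega>)\<^sup>2)) + ?e \<omega> * ?r \<omega>"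
      unfolding of_real_mult of_real_power .
  qed
  also have "\<dots> = phi u k + (\<i> * of_real u) * (CLINT \<omega>|M. ?e \<omega> * complex_of_real (D k \<omega>))
      - (of_real u)\<^sup>2 / 2 * (CLINT \<omega>|M. ?e \<omega> * complex_of_real ((D k \<omega>)\<^sup>2)) + (CLINT \<omega>|M. ?e \<omega> * ?r \<omega>)"
    unfolding phi_def
    by (intro expectation_intros)
  also have "(CLINT \<omega>|M. ?e \<omega> * complex_of_real (D k \<omega>)) = 0"
    by (intro D_mean_complex assms bdd_iexp)
  also have "(CLINT \<omega>|M. ?e \<omega> * complex_of_real ((D k \<omega>)\<^sup>2)) =
     (CLINT \<omega>|M. ?e \<omega> * complex_of_real ((Z k \<omega>)\<^sup>2) + (of_real a)\<^sup>2 * (?e \<omega> * complex_of_real ((Z k \<omega>)^4))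
        - 2 * of_real a * ((?e \<omega> * complex_of_real ((Z k \<omega>)^3)) * complex_of_real (X (Suc k) \<omega>)))"
    by (intro Bochner_Integration.integral_cong refl) (simp add: D_sq algebra_simps)
  also have "\<dots> = eta u k + (of_real a)\<^sup>2 * ?z4
        - 2 * of_real a * (CLINT \<omega>|M. (?e \<omega> * complex_of_real ((Z k \<omega>)^3)) * complex_of_real (X (Suc k) \<omega>))"
    unfolding eta_def
    by (intro expectation_intros)
  also have "(CLINT \<omega>|M. (?e \<omega> * complex_of_real ((Z k \<omega>)^3)) * complex_of_real (X (Suc k) \<omega>)) =
      of_real a * (CLINT \<omega>|M. (?e \<omega> * complex_of_real ((Z k \<omega>)^3)) * complex_of_real (Z k \<omega>))"
    by (intro next_step_mean_complex assms bdd_measurable_intros bdd_N bdd_Z order_refl)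
  also have "(CLINT \<omega>|M. (?e \<omega> * complex_of_real ((Z k \<omega>)^3)) * complex_of_real (Z k \<omega>)) = ?z4"
    by (simp add: eval_nat_numeral mult_ac)
  finally have eq: "phi u (Suc k) - phi u k + (of_real u)\<^sup>2 / 2 * eta u k =
      (of_real u)\<^sup>2 / 2 * (of_real a)\<^sup>2 * ?z4 + (CLINT \<omega>|M. ?e \<omega> * ?r \<omega>)"
    by (rule id1)
  have "cmod (phi u (Suc k) - phi u k + (of_real u)\<^sup>2 / 2 * eta u k) \<le> u\<^sup>2 / 2 * a\<^sup>2 * cmod ?z4 + cmod (CLINT \<omega>|M. ?e \<omega> * ?r \<omega>)"
    unfolding eq using norm_triangle_ineq[of "(of_real u)\<^sup>2 / 2 * (of_real a)\<^sup>2 * ?z4"]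
    by (simp only: norm_mult norm_power norm_divide norm_of_real norm_numeral power2_abs)
  also have "\<dots> \<le> u\<^sup>2 / 2 * 1 * (5 * C\<^sup>2 / (real k)\<^sup>2) + 4 / 3 * \<bar>u\<bar>^3 * (C / real k)"
  proof (rule add_mono[OF mult_mono[OF mult_left_mono]])
    show "a\<^sup>2 \<le> 1" using abs_a_le abs_square_le_1 by blast
    have "cmod ?z4 \<le> expectation (\<lambda>\<omega>. (Z k \<omega>)^4)"
    proof (intro norm_expectation_le bdd_intros)
      show "cmod (?e \<omega> * complex_of_real ((Z k \<omega>)^4)) \<le> (Z k \<omega>)^4" for \<omega>
        unfolding norm_mult norm_exp_i_times norm_of_real by simp
    qed
    with Z_pow4_le[OF assms] show "cmod ?z4 \<le> 5 * C\<^sup>2 / (real k)\<^sup>2" by linarith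
    have "cmod (CLINT \<omega>|M. ?e \<omega> * ?r \<omega>) \<le> expectation (\<lambda>\<omega>. 4 / 3 * \<bar>u\<bar>^3 * (Z k \<omega>)\<^sup>2)"
    proof (intro norm_expectation_le bdd_intros)
      fix \<omega>
      \<comment> \<open>One of the three factors \<open>|Z k|\<close> is bounded by 1, so that the
        second moment controls the cubic term; \<open>8 / 6\<close> gives the constant
        \<open>4 / 3\<close>.\<close>
      have "\<bar>D k \<omega>\<bar>^3 \<le> (2 * \<bar>Z k \<omega>\<bar>)^3"
        by (intro power_mono abs_D_le) simp
      also have "\<dots> \<le> 8 * (\<bar>Z k \<omega>\<bar>)\<^sup>2"
        using mult_left_mono[OF abs_Z_le[of k \<omega>], of "8 * (\<bar>Z k \<omega>\<bar>)\<^sup>2"]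
        by (simp add: eval_nat_numeral algebra_simps)
      finally have "\<bar>u * D k \<omega>\<bar>^3 / 6 \<le> \<bar>u\<bar>^3 * (8 * (\<bar>Z k \<omega>\<bar>)\<^sup>2) / 6"
        unfolding abs_mult power_mult_distrib by (intro divide_right_mono mult_left_mono) auto
      also have "\<dots> = 4 / 3 * \<bar>u\<bar>^3 * (Z k \<omega>)\<^sup>2" by simp
      finally show "cmod (?e \<omega> * ?r \<omega>) \<le> 4 / 3 * \<bar>u\<bar>^3 * (Z k \<omega>)\<^sup>2"
        unfolding norm_mult norm_exp_i_times mult_1_left
        by (rule order_trans[OF iexp_order2_le])
    qed
    also have "\<dots> = 4 / 3 * \<bar>u\<bar>^3 * expectation (\<lambda>\<omega>. (Z k \<omega>)\<^sup>2)" by simp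
    also have "\<dots> \<le> 4 / 3 * \<bar>u\<bar>^3 * (C / real k)"
      by (intro mult_left_mono Z_sq_le assms) auto
    finally show "cmod (CLINT \<omega>|M. ?e \<omega> * ?r \<omega>) \<le> 4 / 3 * \<bar>u\<bar>^3 * (C / real k)" .
  qed (rule norm_ge_zero | simp)+
  also have "\<dots> \<le> u\<^sup>2 * (3 * C\<^sup>2 / (real k)\<^sup>2) + 3 * \<bar>u\<bar>^3 * (C\<^sup>2 / real k)"
  proof (rule add_mono)
    show "u\<^sup>2 / 2 * 1 * (5 * C\<^sup>2 / (real k)\<^sup>2) \<le> u\<^sup>2 * (3 * C\<^sup>2 / (real k)\<^sup>2)"
    proof -
      have "u\<^sup>2 * (5 / 2) * (C\<^sup>2 / (real k)\<^sup>2) \<le> u\<^sup>2 * 3 * (C\<^sup>2 / (real k)\<^sup>2)"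
        by (intro mult_right_mono mult_left_mono) auto
      then show ?thesis by simp
    qed
    have "C \<le> C\<^sup>2" using C_ge_1 by (rule self_le_power) simp
    then show "4 / 3 * \<bar>u\<bar>^3 * (C / real k) \<le> 3 * \<bar>u\<bar>^3 * (C\<^sup>2 / real k)"
      using C_pos by (intro mult_mono divide_right_mono) auto
  qed
  finally show ?thesis by (simp add: algebra_simps)
qed

lemma Y_Suc:
  assumes "1 \<le> k"
  shows "Y (Suc k) \<omega> = Y k \<omega> + (2 * real k * (Z k \<omega> * X (Suc k) \<omega>) + 1 - real k * (Z k \<omega>)\<^sup>2) / real (Suc k)"
proof -
  have S: "S k \<omega> = real k * Z k \<omega>" using assms by (simp add: Z_def)
  have "Y (Suc k) \<omega> = (S (Suc k) \<omega>)\<^sup>2 / real (Suc k)"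
    by (simp add: Y_def Z_def power2_eq_square)
  also have "(S (Suc k) \<omega>)\<^sup>2 = (real k * Z k \<omega>)\<^sup>2 + 2 * real k * (Z k \<omega> * X (Suc k) \<omega>) + 1"
    by (simp add: S_Suc power2_sum S)
  finally have eq: "real (Suc k) * Y (Suc k) \<omega> = (real k * Z k \<omega>)\<^sup>2 + 2 * real k * (Z k \<omega> * X (Suc k) \<omega>) + 1"
    by simp
  also have "\<dots> = real (Suc k) * (Y k \<omega> + (2 * real k * (Z k \<omega> * X (Suc k) \<omega>) + 1 - real k * (Z k \<omega>)\<^sup>2) / real (Suc k))"
    by (simp add: Y_def distrib_left del: of_nat_Suc) (simp add: power2_eq_square algebra_simps)
  finally show ?thesis by simp
qed

text \<open>\<open>Y\<close> has drift \<open>1 / (k + 1) - (1 - 2 a) (Z k)^2\<close> up to a small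
  term. The exponential moves together with \<open>Y\<close>, and the danger is the cross term
  \<open>i u D k * Y k\<close>, typically of order \<open>|u| / sqrt k\<close>. It has mean zero
  because \<open>Y k\<close> is known at time \<open>k\<close>; what remains is of order
  \<open>|u| / k\<close> or \<open>1 / k^2\<close>, which becomes summable enough after
  multiplication by \<open>u^2\<close>.\<close>

lemma eta_approx:
  assumes k: "1 \<le> k" and u: "\<bar>u\<bar> \<le> 1"
  shows "cmod ((1 - 2 * of_real a) * eta u k - (phi u k / of_nat (Suc k) + gam u k - gam u (Suc k)))
    \<le> 18 * C\<^sup>2 * (\<bar>u\<bar> / real k) + 3 * C\<^sup>2 / (real k)\<^sup>2"
proof -
  define w where "w = real k / real (Suc k)"
  let ?e = "\<lambda>\<omega>. iexp (u * N k \<omega>)"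
  let ?x = "\<lambda>\<omega>. iexp (u * D k \<omega>)"
  let ?d = "\<lambda>\<omega>. Y (Suc k) \<omega> - Y k \<omega>"
  let ?r = "\<lambda>\<omega>. (?x \<omega> - 1 - \<i> * of_real (u * D k \<omega>)) * complex_of_real (Y k \<omega>)
     + (?x \<omega> - 1) * complex_of_real (?d \<omega>) + complex_of_real ((1 - 2 * a) * (Z k \<omega>)\<^sup>2 / real (Suc k))"
  let ?b = "\<lambda>\<omega>. 2 * u\<^sup>2 * real k * (Z k \<omega>)^4 + \<bar>u\<bar> * (7 * (Z k \<omega>)\<^sup>2 + 1 / (real k)\<^sup>2) + 3 / real k * (Z k \<omega>)\<^sup>2"
  \<comment> \<open>Writing \<open>X (k + 1)\<close> as the martingale difference plus
    \<open>a * Z k\<close> and \<open>w = 1 - 1 / (k + 1)\<close> separates the martingale part, the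
    main drift and a correction smaller by the factor \<open>1 / (k + 1)\<close>.\<close>
  have d: "?d \<omega> = 2 * w * D k \<omega> - (1 - 2 * a) * (Z k \<omega>)\<^sup>2 + (1 - 2 * a) * (Z k \<omega>)\<^sup>2 / real (Suc k) + 1 / real (Suc k)" for \<omega>
  proof -
    have id0: "(2 * r * (z * x) + 1 - r * z\<^sup>2) / s
        = 2 * (r / s) * (z * (x - a * z)) - (1 - 2 * a) * z\<^sup>2 + (1 - 2 * a) * z\<^sup>2 / s + 1 / s"
      if "r = s - 1" "s \<noteq> 0" for r s z x :: real
      using that(2) unfolding that(1)
      by (simp add: divide_simps) (simp add: algebra_simps power2_eq_square)
    show ?thesis
      unfolding Y_Suc[OF k] w_def D_def by (subst id0) auto
  qed
  have id1: "c * h - (p / s + g - P) = R"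
    if "P = inverse s * p + g - c * h + R + 0" for P p s g c h R :: complex
    unfolding that by (simp add: divide_inverse)
  \<comment> \<open>The terms are grouped so that everything linear in \<open>D k\<close> has a
    coefficient measurable at time \<open>k\<close>; this last group integrates to 0, and
    \<open>?r\<close> collects the errors.\<close>
  have "gam u (Suc k) = (CLINT \<omega>|M. inverse (of_nat (Suc k)) * ?e \<omega> + ?e \<omega> * complex_of_real (Y k \<omega>)
        - (1 - 2 * of_real a) * (?e \<omega> * complex_of_real ((Z k \<omega>)\<^sup>2)) + ?e \<omega> * ?r \<omega>
        + (?e \<omega> * (\<i> * of_real (u * Y k \<omega>) + of_real (2 * w))) * complex_of_real (D k \<omega>))"
    unfolding gam_def
  proof (intro Bochner_Integration.integral_cong refl)
    fix \<omega>
    have id: "e * x * (y + d) = inverse s * e + e * y - c * (e * z2)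
       + e * ((x - 1 - \<i> * (v * dd)) * y + (x - 1) * d + c * z2 / s) + (e * (\<i> * (v * y) + w')) * dd"
      if "d = w' * dd - c * z2 + c * z2 / s + 1 / s" for e x y d c s z2 v dd w' :: complex
      unfolding that by (simp add: algebra_simps divide_inverse)
    have d': "complex_of_real (?d \<omega>) = of_real (2 * w) * of_real (D k \<omega>) - (1 - 2 * of_real a) * of_real ((Z k \<omega>)\<^sup>2)
         + (1 - 2 * of_real a) * of_real ((Z k \<omega>)\<^sup>2) / of_nat (Suc k) + 1 / of_nat (Suc k)"
      unfolding d by simp
    have "iexp (u * N (Suc k) \<omega>) * complex_of_real (Y (Suc k) \<omega>) =
      ?e \<omega> * ?x \<omega> * (complex_of_real (Y k \<omega>) + complex_of_real (?d \<omega>))"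
      unfolding iexp_N_Suc[OF k] by simp
    also have "\<dots> = inverse (of_nat (Suc k)) * ?e \<omega> + ?e \<omega> * complex_of_real (Y k \<omega>)
        - (1 - 2 * of_real a) * (?e \<omega> * complex_of_real ((Z k \<omega>)\<^sup>2)) + ?e \<omega> * ?r \<omega>
        + (?e \<omega> * (\<i> * of_real (u * Y k \<omega>) + of_real (2 * w))) * complex_of_real (D k \<omega>)"
      using id[OF d', of "?e \<omega>" "?x \<omega>" "complex_of_real (Y k \<omega>)" "of_real u"]
      unfolding of_real_mult of_real_divide of_real_diff of_real_1 of_real_numeral of_real_of_nat_eq .
    finally show "iexp (u * N (Suc k) \<omega>) * complex_of_real (Y (Suc k) \<omega>) = \<dots>" .
  qed
  also have "\<dots> = inverse (of_nat (Suc k)) * phi u k + gam u k - (1 - 2 * of_real a) * eta u k + (CLINT \<omega>|M. ?e \<omega> * ?r \<omega>)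
      + (CLINT \<omega>|M. (?e \<omega> * (\<i> * of_real (u * Y k \<omega>) + of_real (2 * w))) * complex_of_real (D k \<omega>))"
    unfolding phi_def gam_def eta_def
    by (intro expectation_intros)
  also have "(CLINT \<omega>|M. (?e \<omega> * (\<i> * of_real (u * Y k \<omega>) + of_real (2 * w))) * complex_of_real (D k \<omega>)) = 0"
    by (intro D_mean_complex k bdd_measurable_intros bdd_N bdd_Y)
  finally have eq: "(1 - 2 * of_real a) * eta u k - (phi u k / of_nat (Suc k) + gam u k - gam u (Suc k)) =
      (CLINT \<omega>|M. ?e \<omega> * ?r \<omega>)"
    by (rule id1)
  have "cmod ((1 - 2 * of_real a) * eta u k - (phi u k / of_nat (Suc k) + gam u k - gam u (Suc k))) \<le> expectation ?b"
    unfolding eq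
  proof (intro norm_expectation_le bdd_intros bdd_M[OF bdd_Y])
    fix \<omega>
    let ?z = "\<bar>Z k \<omega>\<bar>"
    have uD: "\<bar>u * D k \<omega>\<bar> \<le> 2 * \<bar>u\<bar> * ?z"
      unfolding abs_mult using mult_left_mono[OF abs_D_le[of k \<omega>], of "\<bar>u\<bar>"] by simp
    have "cmod ((?x \<omega> - 1 - \<i> * of_real (u * D k \<omega>)) * complex_of_real (Y k \<omega>)) \<le> (u * D k \<omega>)\<^sup>2 / 2 * Y k \<omega>"
      unfolding norm_mult norm_of_real
      by (intro mult_mono iexp_order1_le) (auto simp: Y_def)
    also have "\<dots> \<le> (2 * \<bar>u\<bar> * ?z)\<^sup>2 / 2 * Y k \<omega>"
      using power_mono[OF uD abs_ge_zero, of 2] by (intro mult_right_mono divide_right_mono) (auto simp: Y_def)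
    also have "\<dots> = 2 * u\<^sup>2 * real k * (Z k \<omega>)^4"
      by (simp add: Y_def power_mult_distrib eval_nat_numeral mult_ac)
    finally have 1: "cmod ((?x \<omega> - 1 - \<i> * of_real (u * D k \<omega>)) * complex_of_real (Y k \<omega>)) \<le> 2 * u\<^sup>2 * real k * (Z k \<omega>)^4" .
    have "\<bar>?d \<omega>\<bar> \<le> 3 * ?z + 1 / real k"
    proof -
      have "\<bar>?d \<omega>\<bar> = \<bar>w * (2 * (Z k \<omega> * X (Suc k) \<omega>) - (Z k \<omega>)\<^sup>2) + 1 / real (Suc k)\<bar>"
        unfolding Y_Suc[OF k] w_def by (simp add: field_simps)
      also have "\<dots> \<le> w * (2 * ?z + (Z k \<omega>)\<^sup>2) + 1 / real (Suc k)"
      proof -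
        have "\<bar>w * (2 * (Z k \<omega> * X (Suc k) \<omega>) - (Z k \<omega>)\<^sup>2)\<bar> \<le> w * (2 * ?z + (Z k \<omega>)\<^sup>2)"
          unfolding abs_mult[of w]
          using abs_triangle_ineq4[of "2 * (Z k \<omega> * X (Suc k) \<omega>)" "(Z k \<omega>)\<^sup>2"]
          by (intro mult_mono) (auto simp: w_def abs_mult)
        then show ?thesis by (intro order_trans[OF abs_triangle_ineq] add_mono) auto
      qed
      also have "\<dots> \<le> 1 * (2 * ?z + ?z) + 1 / real k"
      proof (intro add_mono mult_mono order_refl)
        show "(Z k \<omega>)\<^sup>2 \<le> ?z"
          using mult_left_mono[OF abs_Z_le[of k \<omega>], of ?z] by (simp add: power2_eq_square flip: abs_mult)
      qed (use k in \<open>auto simp: w_def field_simps\<close>)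
      finally show ?thesis by simp
    qed
    then have "cmod ((?x \<omega> - 1) * complex_of_real (?d \<omega>)) \<le> (2 * \<bar>u\<bar> * ?z) * (3 * ?z + 1 / real k)"
      unfolding norm_mult norm_of_real
      by (intro mult_mono order_trans[OF iexp_minus_1_le uD]) auto
    also have "\<dots> = \<bar>u\<bar> * (6 * ?z\<^sup>2 + 2 * ?z * (1 / real k))"
      by (simp add: algebra_simps power2_eq_square)
    \<comment> \<open>The inequality between arithmetic and geometric means removes the first power
      of \<open>|Z k|\<close>, so that only its second moment is used.\<close>
    also have "\<dots> \<le> \<bar>u\<bar> * (6 * ?z\<^sup>2 + (?z\<^sup>2 + (1 / real k)\<^sup>2))"
      using sum_squares_bound[of ?z "1 / real k"] by (intro mult_left_mono add_left_mono) auto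
    also have "\<dots> = \<bar>u\<bar> * (7 * (Z k \<omega>)\<^sup>2 + 1 / (real k)\<^sup>2)"
      by (simp add: power_divide)
    finally have 2: "cmod ((?x \<omega> - 1) * complex_of_real (?d \<omega>)) \<le> \<bar>u\<bar> * (7 * (Z k \<omega>)\<^sup>2 + 1 / (real k)\<^sup>2)" .
    have "cmod (complex_of_real ((1 - 2 * a) * (Z k \<omega>)\<^sup>2 / real (Suc k))) = (1 - 2 * a) / real (Suc k) * (Z k \<omega>)\<^sup>2"
      unfolding norm_of_real using a_less by simp
    also have "\<dots> \<le> 3 / real k * (Z k \<omega>)\<^sup>2"
      using a_ge a_less k by (intro mult_right_mono frac_le) auto
    finally have 3: "cmod (complex_of_real ((1 - 2 * a) * (Z k \<omega>)\<^sup>2 / real (Suc k))) \<le> 3 / real k * (Z k \<omega>)\<^sup>2" .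
    have "cmod (?e \<omega> * ?r \<omega>) = cmod (?r \<omega>)"
      unfolding norm_mult norm_exp_i_times by (rule mult_1_left)
    also have "\<dots> \<le> ?b \<omega>"
      by (intro norm_triangle_mono 1 2 3)
    finally show "cmod (?e \<omega> * ?r \<omega>) \<le> ?b \<omega>" .
  qed
  also have "expectation ?b = 2 * u\<^sup>2 * real k * expectation (\<lambda>\<omega>. (Z k \<omega>)^4)
      + \<bar>u\<bar> * (7 * expectation (\<lambda>\<omega>. (Z k \<omega>)\<^sup>2) + 1 / (real k)\<^sup>2) + 3 / real k * expectation (\<lambda>\<omega>. (Z k \<omega>)\<^sup>2)"
  proof -
    have const: "1 / (real k)\<^sup>2 = expectation (\<lambda>\<omega>. 1 / (real k)\<^sup>2)" by (simp add: prob_space)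
    show ?thesis by (subst (2) const) (intro expectation_intros)
  qed
  also have "\<dots> \<le> 2 * u\<^sup>2 * real k * (5 * C\<^sup>2 / (real k)\<^sup>2) + \<bar>u\<bar> * (7 * (C / real k) + 1 / (real k)\<^sup>2) + 3 / real k * (C / real k)"
    by (intro add_mono mult_left_mono Z_sq_le Z_pow4_le k order_refl) auto
  also have "\<dots> \<le> 10 * \<bar>u\<bar> * (C\<^sup>2 / real k) + \<bar>u\<bar> * (8 * (C\<^sup>2 / real k)) + 3 / real k * (C\<^sup>2 / real k)"
  proof (intro add_mono mult_left_mono divide_right_mono)
    have CC: "C \<le> C\<^sup>2" using C_ge_1 by (rule self_le_power) simp
    then show "C \<le> C\<^sup>2" .
    have "u\<^sup>2 \<le> \<bar>u\<bar>" using mult_left_mono[OF u, of "\<bar>u\<bar>"] by (simp add: power2_eq_square flip: abs_mult)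
    then have "10 * (u\<^sup>2 * (C\<^sup>2 / real k)) \<le> 10 * (\<bar>u\<bar> * (C\<^sup>2 / real k))"
      by (intro mult_left_mono mult_right_mono) auto
    then show "2 * u\<^sup>2 * real k * (5 * C\<^sup>2 / (real k)\<^sup>2) \<le> 10 * \<bar>u\<bar> * (C\<^sup>2 / real k)"
      using k by (simp add: power2_eq_square)
    have "1 / (real k)\<^sup>2 \<le> C\<^sup>2 / real k"
    proof (rule frac_le)
      show "1 \<le> C\<^sup>2" using CC C_ge_1 by linarith
      show "real k \<le> (real k)\<^sup>2" using k by (intro self_le_power) auto
    qed (use k in auto)
    moreover have "C / real k \<le> C\<^sup>2 / real k" using CC by (intro divide_right_mono) auto
    ultimately show "7 * (C / real k) + 1 / (real k)\<^sup>2 \<le> 8 * (C\<^sup>2 / real k)" by simp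
  qed auto
  finally show ?thesis by (simp add: power2_eq_square algebra_simps)
qed

end

section \<open>Distribution function and quantiles of the standard normal law\<close>

lemma std_normal_distribution_uminus: "distr std_normal_distribution borel uminus = std_normal_distribution"
proof (rule Levy_uniqueness)
  interpret real_distribution std_normal_distribution by (rule real_dist_normal_dist)
  show "real_distribution (distr std_normal_distribution borel uminus)"
    by (rule real_distribution_distr) simp
  show "char (distr std_normal_distribution borel uminus) = char std_normal_distribution"
  proof
    fix t
    have "char (distr std_normal_distribution borel uminus) t = char std_normal_distribution (- t)"
      unfolding char_def by (subst integral_distr) simp_all
    also have "\<dots> = char std_normal_distribution t"
      by (simp add: char_std_normal_distribution)
    finally show "char (distr std_normal_distribution borel uminus) t = char std_normal_distribution t" .
  qed
qed (rule real_dist_normal_dist)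

lemma measure_std_normal_singleton: "measure std_normal_distribution {x} = 0"
  by (simp add: measure_def emeasure_density)

lemma cdf_std_normal_uminus: "cdf std_normal_distribution (- x) = 1 - cdf std_normal_distribution x"
proof -
  interpret real_distribution std_normal_distribution by (rule real_dist_normal_dist)
  have "cdf std_normal_distribution (- x) = measure (distr std_normal_distribution borel uminus) {..- x}"
    by (simp add: std_normal_distribution_uminus cdf_def2)
  also have "\<dots> = prob {x..}"
    by (subst measure_distr) (auto intro!: arg_cong[where f = prob])
  also have "{x..} = space std_normal_distribution - {..<x}" by auto
  also have "prob \<dots> = 1 - prob {..<x}" by (rule prob_compl) simp
  \<comment> \<open>Adding the null point \<open>x\<close> turns the open half-line into the closed
    one of the distribution function.\<close>
  also have "prob {..<x} = prob {..<x} + prob {x}" by (simp add: measure_std_normal_singleton)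
  also have "\<dots> = prob ({..<x} \<union> {x})" by (subst finite_measure_Union) auto
  also have "{..<x} \<union> {x} = {..x}" by auto
  finally show ?thesis by (simp add: cdf_def2)
qed

lemma isCont_cdf_std_normal: "isCont (cdf std_normal_distribution) x"
proof -
  interpret real_distribution std_normal_distribution by (rule real_dist_normal_dist)
  show ?thesis by (simp add: isCont_cdf measure_std_normal_singleton)
qed

text \<open>By continuity the set in \<open>quantile\<close> is closed and contains its infimum,
  which gives one inequality. The intermediate value theorem supplies a point of value exactly
  \<open>u\<close>, lying above the infimum, and monotonicity gives the other.\<close>

lemma cdf_quantile_std_normal:
  assumes "0 < u" "u < 1"
  shows "cdf std_normal_distribution (quantile std_normal_distribution u) = u"
proof -
  interpret real_distribution std_normal_distribution by (rule real_dist_normal_dist)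
  let ?F = "cdf std_normal_distribution" and ?A = "{x. u \<le> cdf std_normal_distribution x}"
  obtain y where y: "?F y \<ge> u"
    using order_tendstoD(1)[OF cdf_lim_at_top_prob assms(2)]
    by (auto simp: eventually_at_top_linorder intro: less_imp_le)
  obtain z where z: "?F z < u"
    using order_tendstoD(2)[OF cdf_lim_at_bot assms(1)]
    by (auto simp: eventually_at_bot_linorder)
  have cont: "continuous_on T ?F" for T
    by (intro continuous_at_imp_continuous_on ballI isCont_cdf_std_normal)
  have bdd: "bdd_below ?A"
  proof (rule bdd_belowI[of _ z])
    fix x assume "x \<in> ?A"
    then have "?F z < ?F x" using z by simp
    then show "z \<le> x" using cdf_nondecreasing[of x z] by linarith
  qed
  have "closed ?A"
    by (intro closed_Collect_le continuous_on_const cont)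
  then have ge: "u \<le> ?F (Inf ?A)" using closed_contains_Inf[OF _ bdd] y by blast
  have "z \<le> y" using y z cdf_nondecreasing[of y z] by linarith
  then obtain x where x: "?F x = u"
    using IVT'[OF _ y _ cont, of z] z by (meson less_imp_le)
  then have "Inf ?A \<le> x" using bdd by (intro cInf_lower) auto
  then have "?F (Inf ?A) \<le> u" using cdf_nondecreasing[of "Inf ?A" x] x by linarith
  with ge show ?thesis unfolding quantile_def by linarith
qed

lemma quantile_std_normal_pos:
  assumes "1 / 2 < u" "u < 1"
  shows "0 < quantile std_normal_distribution u"
proof (rule ccontr)
  interpret real_distribution std_normal_distribution by (rule real_dist_normal_dist)
  assume "\<not> 0 < quantile std_normal_distribution u"
  then have "u \<le> cdf std_normal_distribution 0"
    using cdf_nondecreasing[of "quantile std_normal_distribution u" 0] assms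
    by (simp add: cdf_quantile_std_normal)
  with cdf_std_normal_uminus[of 0] assms show False by simp
qed

lemma filterlim_ln_real_at_infinity: "filterlim (\<lambda>n. ln (real n)) at_infinity sequentially"
  by (intro filterlim_at_top_imp_at_infinity filterlim_compose[OF ln_at_top filterlim_real_sequentially])

lemma harm_over_ln: "(\<lambda>n. harm n / ln (real n)) \<longlonglongrightarrow> 1"
proof -
  have "(\<lambda>n. (harm n - ln (real n)) / ln (real n) + 1) \<longlonglongrightarrow> 0 + 1"
    using tendsto_divide_0[OF euler_mascheroni_LIMSEQ filterlim_ln_real_at_infinity]
    by (intro tendsto_add) auto
  moreover have "eventually (\<lambda>n. (harm n - ln (real n)) / ln (real n) + 1 = harm n / ln (real n)) sequentially"
    using eventually_gt_at_top[of 1] by eventually_elim (simp add: field_simps)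
  ultimately show ?thesis by (simp add: tendsto_cong)
qed

section \<open>Scalar recursion for the corrected characteristic function\<close>

context erw_martingale
begin

text \<open>Chosen so that \<open>c * (1 - 2 * a) = 1 / 2\<close>: subtracting
  \<open>c * u^2\<close> times the relation for \<open>eta\<close> cancels the term
  \<open>u^2 / 2 * eta\<close> in the expansion of \<open>phi\<close>.\<close>

definition c :: real where "c = 1 / (2 * (1 - 2 * a))"

lemma c_pos: "0 < c" and c_le: "c \<le> C / 2"
  using a_less by (auto simp: c_def C_def field_simps)

text \<open>The correction absorbs the telescoping difference of \<open>gam\<close> in \<open>eta_approx\<close>, so that \<open>psi\<close>
  satisfies a one-step linear recursion.\<close>

definition psi :: "real \<Rightarrow> nat \<Rightarrow> complex" where
  "psi u k = phi u k - of_real (c * u\<^sup>2) * gam u k"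

lemma norm_phi_le: "cmod (phi u k) \<le> 1"
  unfolding phi_def
  using norm_expectation_le[of "\<lambda>\<omega>. iexp (u * N k \<omega>)" "\<lambda>_. 1"] bdd_M[OF bdd_iexp]
  by (simp add: bdd_measurable_const prob_space)

lemma Y_mean_le: "1 \<le> k \<Longrightarrow> expectation (Y k) \<le> C"
  using Z_sq_le[of k] unfolding Y_def[abs_def] by (simp add: field_simps)

lemma norm_gam_le: assumes "1 \<le> k" shows "cmod (gam u k) \<le> C"
proof -
  have "cmod (gam u k) \<le> expectation (Y k)"
    unfolding gam_def
  proof (rule norm_expectation_le)
    show "cmod (iexp (u * N k \<omega>) * complex_of_real (Y k \<omega>)) \<le> Y k \<omega>" for \<omega>
      unfolding norm_mult norm_exp_i_times norm_of_real by (simp add: Y_def)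
  qed (intro bdd_intros bdd_M[OF bdd_Y])+
  with Y_mean_le[OF assms] show ?thesis by linarith
qed

lemma cu_le: "c * u\<^sup>2 \<le> C / 2 * u\<^sup>2"
  using c_le by (intro mult_right_mono) auto

lemma u_sq_le: "\<bar>u\<bar> \<le> 1 \<Longrightarrow> (u::real)\<^sup>2 \<le> 1"
  using abs_square_le_1 by blast

lemma power4_le: "\<bar>u\<bar> \<le> 1 \<Longrightarrow> (u::real)^4 \<le> u\<^sup>2" "\<bar>u\<bar> \<le> 1 \<Longrightarrow> (u::real)^4 \<le> \<bar>u\<bar>^3"
  using power_decreasing[of 2 4 "\<bar>u\<bar>"] power_decreasing[of 3 4 "\<bar>u\<bar>"] by auto

text \<open>Subtracting \<open>c * u^2\<close> times \<open>eta_approx\<close> from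
  \<open>phi_Suc_approx\<close> eliminates \<open>eta\<close>. Writing the result in terms of
  \<open>psi\<close> instead of \<open>phi\<close> costs one extra term with
  \<open>(c * u^2)^2 * gam / (k + 1)\<close>, harmless because \<open>gam\<close> is bounded and
  \<open>u^4 \<le> |u|^3\<close>.\<close>

lemma psi_step:
  assumes k: "1 \<le> k" and u: "\<bar>u\<bar> \<le> 1"
  shows "cmod (psi u (Suc k) - of_real (1 - c * u\<^sup>2 / real (Suc k)) * psi u k)
    \<le> 13 * C^3 * (\<bar>u\<bar>^3 / real k + u\<^sup>2 / (real k)\<^sup>2)"
proof -
  define x where "x = c * u\<^sup>2"
  define P where "P = \<bar>u\<bar>^3 / real k"
  define Q where "Q = u\<^sup>2 / (real k)\<^sup>2"
  have PQ: "0 \<le> P" "0 \<le> Q" by (auto simp: P_def Q_def)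
  have x: "0 \<le> x" "x \<le> C / 2 * u\<^sup>2" using c_pos cu_le by (auto simp: x_def)
  define RA where "RA = phi u (Suc k) - phi u k + (of_real u)\<^sup>2 / 2 * eta u k"
  define RB where "RB = (1 - 2 * of_real a) * eta u k - (phi u k / of_nat (Suc k) + gam u k - gam u (Suc k))"
  have RA: "cmod RA \<le> 3 * C\<^sup>2 * (P + Q)"
    unfolding RA_def P_def Q_def by (rule phi_Suc_approx[OF k])
  have RB: "cmod RB \<le> 18 * C\<^sup>2 * (\<bar>u\<bar> / real k) + 3 * C\<^sup>2 / (real k)\<^sup>2"
    unfolding RB_def by (rule eta_approx[OF k u])
  have half: "(of_real u)\<^sup>2 / 2 = of_real x * (1 - 2 * complex_of_real a)"
  proof -
    have "c * (1 - 2 * a) = 1 / 2" using a_less by (simp add: c_def field_simps)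
    then have "u\<^sup>2 / 2 = x * (1 - 2 * a)" by (simp add: x_def mult.commute mult.left_commute)
    then have "complex_of_real (u\<^sup>2 / 2) = complex_of_real (x * (1 - 2 * a))" by simp
    then show ?thesis by simp
  qed
  have "f' - x * g' - (1 - x / s) * (f - x * g) =
     (f' - f + v * h) - x * (b * h - (f / s + g - g')) - x * x * g / s"
    if "v = x * b" for f f' g g' x s v h b :: complex
    unfolding that by (simp add: algebra_simps divide_inverse)
  from this[OF half, of "phi u (Suc k)" "gam u (Suc k)" "of_nat (Suc k)" "phi u k" "gam u k" "eta u k"]
  have eq: "psi u (Suc k) - of_real (1 - x / real (Suc k)) * psi u k =
     RA - of_real x * RB - of_real x * of_real x * gam u k / of_nat (Suc k)"
    unfolding psi_def RA_def RB_def x_def[symmetric] of_real_diff of_real_divide of_real_1 of_real_of_nat_eq .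
  have "cmod (psi u (Suc k) - of_real (1 - x / real (Suc k)) * psi u k)
    \<le> cmod RA + cmod (of_real x * RB) + cmod (of_real x * of_real x * gam u k / of_nat (Suc k))"
    unfolding eq by (rule order_trans[OF norm_triangle_ineq4 add_right_mono[OF norm_triangle_ineq4]])
  also have "\<dots> = cmod RA + x * cmod RB + x * x * (cmod (gam u k) / real (Suc k))"
    using x by (simp add: norm_mult norm_divide del: of_nat_Suc)
  also have "\<dots> \<le> 3 * C\<^sup>2 * (P + Q) + C / 2 * u\<^sup>2 * (18 * C\<^sup>2 * (\<bar>u\<bar> / real k) + 3 * C\<^sup>2 / (real k)\<^sup>2)
      + (C / 2 * u\<^sup>2) * (C / 2 * u\<^sup>2) * (C / real k)"
    using x RA RB norm_gam_le[OF k, of u] C_pos k by (intro add_mono mult_mono frac_le) auto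
  also have "\<dots> = 3 * C\<^sup>2 * (P + Q) + (9 * C^3 * P + 3 / 2 * C^3 * Q) + C^3 / 4 * (u^4 / real k)"
  proof -
    have id: "3 * K\<^sup>2 * (v * w * i + v * i\<^sup>2) + K / 2 * v * (18 * K\<^sup>2 * (w * i) + 3 * K\<^sup>2 * i\<^sup>2)
        + (K / 2 * v) * (K / 2 * v) * (K * i) =
        3 * K\<^sup>2 * (v * w * i + v * i\<^sup>2) + (9 * K^3 * (v * w * i) + 3 / 2 * K^3 * (v * i\<^sup>2)) + K^3 / 4 * (v\<^sup>2 * i)"
      for K v w i :: real
      by (simp add: power2_eq_square power3_eq_cube) (simp add: algebra_simps)
    have "\<bar>u\<bar>^3 = u\<^sup>2 * \<bar>u\<bar>" by (simp add: power3_eq_cube power2_eq_square)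
    moreover have "u^4 = (u\<^sup>2)\<^sup>2" by simp
    ultimately show ?thesis
      using id[of C "u\<^sup>2" "\<bar>u\<bar>" "inverse (real k)"] unfolding P_def Q_def
      by (simp only: divide_inverse power_inverse)
  qed
  also have "\<dots> \<le> 3 * C^3 * (P + Q) + (9 * C^3 * P + 3 / 2 * C^3 * Q) + C^3 / 4 * P"
  proof (intro add_mono mult_left_mono order_refl mult_right_mono)
    show "C\<^sup>2 \<le> C^3" using C_ge_1 by (intro power_increasing) auto
    show "u^4 / real k \<le> P" unfolding P_def by (intro divide_right_mono power4_le u) auto
  qed (use C_pos PQ in auto)
  \<comment> \<open>The coefficients of \<open>C^3 * P\<close> and \<open>C^3 * Q\<close> are 12 1/4
    and 4 1/2.\<close>
  also have "\<dots> \<le> 13 * C^3 * (P + Q)"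
  proof -
    have "0 \<le> C^3 * P" "0 \<le> C^3 * Q" using PQ C_pos by auto
    then show ?thesis unfolding distrib_left mult.assoc by linarith
  qed
  finally show ?thesis by (simp only: x_def P_def Q_def)
qed

text \<open>Replacing \<open>1 - y\<close> by \<open>exp (- y)\<close> costs \<open>y^2 / 2\<close>,
  which is of order \<open>u^4 / k^2\<close> and within the existing error. In exchange the product
  of the factors becomes exactly an exponential of a harmonic number.\<close>

lemma psi_exp_step:
  assumes k: "1 \<le> k" and u: "\<bar>u\<bar> \<le> 1"
  shows "cmod (psi u (Suc k) - of_real (exp (- (c * u\<^sup>2 / real (Suc k)))) * psi u k)
    \<le> 14 * C^4 * (\<bar>u\<bar>^3 / real k + u\<^sup>2 / (real k)\<^sup>2)"
proof -
  define x where "x = c * u\<^sup>2"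
  define B where "B = \<bar>u\<bar>^3 / real k + u\<^sup>2 / (real k)\<^sup>2"
  let ?y = "x / real (Suc k)"
  have x: "0 \<le> x" "x \<le> C / 2 * u\<^sup>2" using c_pos cu_le by (auto simp: x_def)
  have B: "0 \<le> B" "u\<^sup>2 / (real k)\<^sup>2 \<le> B" by (auto simp: B_def)
  have "cmod (psi u k) \<le> cmod (phi u k) + x * cmod (gam u k)"
    unfolding psi_def x_def[symmetric]
    by (rule order_trans[OF norm_triangle_ineq4]) (use x in \<open>simp add: norm_mult\<close>)
  also have "\<dots> \<le> 1 + C / 2 * 1 * C"
    using x u_sq_le[OF u] C_pos
    by (intro add_mono mult_mono norm_phi_le norm_gam_le k order_trans[OF x(2)] mult_left_mono) auto
  also have "\<dots> \<le> C\<^sup>2 + C\<^sup>2"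
    using power_mono[OF C_ge_1, of 2] C_pos by (simp add: power2_eq_square)
  finally have psi: "cmod (psi u k) \<le> 2 * C\<^sup>2" by simp
  have "\<bar>exp (- ?y) - (1 - ?y)\<bar> \<le> ?y\<^sup>2 / 2"
    using x by (intro abs_exp_minus_le) auto
  also have "?y\<^sup>2 / 2 \<le> (C / 2 * u\<^sup>2 / real k)\<^sup>2 / 2"
    using x k by (intro divide_right_mono power_mono frac_le) auto
  also have "\<dots> = C\<^sup>2 / 8 * (u^4 / (real k)\<^sup>2)"
    by (simp add: power_divide power_mult_distrib eval_nat_numeral)
  also have "\<dots> \<le> C\<^sup>2 / 8 * B"
    by (intro mult_left_mono order_trans[OF _ B(2)] divide_right_mono power4_le u) auto
  finally have exp: "\<bar>exp (- ?y) - (1 - ?y)\<bar> \<le> C\<^sup>2 / 8 * B" .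
  have "psi u (Suc k) - of_real (exp (- ?y)) * psi u k =
      (psi u (Suc k) - of_real (1 - ?y) * psi u k) - of_real (exp (- ?y) - (1 - ?y)) * psi u k"
    by (simp add: algebra_simps)
  then have "cmod (psi u (Suc k) - of_real (exp (- ?y)) * psi u k) \<le>
      cmod (psi u (Suc k) - of_real (1 - ?y) * psi u k) + \<bar>exp (- ?y) - (1 - ?y)\<bar> * cmod (psi u k)"
    using norm_triangle_ineq4[of "psi u (Suc k) - of_real (1 - ?y) * psi u k" "of_real (exp (- ?y) - (1 - ?y)) * psi u k"]
    by (simp only: norm_mult norm_of_real)
  also have "\<dots> \<le> 13 * C^3 * B + (C\<^sup>2 / 8 * B) * (2 * C\<^sup>2)"
    unfolding x_def B_def
    by (intro add_mono mult_mono psi_step k u psi exp[unfolded x_def B_def]) (use C_pos in auto)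
  also have "\<dots> = 13 * (C^3 * B) + C^4 / 4 * B" by (simp add: eval_nat_numeral)
  also have "\<dots> \<le> 13 * (C^4 * B) + C^4 * B"
  proof -
    have "C^3 * B \<le> C^4 * B"
      using C_ge_1 B by (intro mult_right_mono power_increasing) auto
    moreover have "0 \<le> C^4 * B" using C_pos B by simp
    ultimately show ?thesis by linarith
  qed
  finally show ?thesis by (simp add: x_def B_def algebra_simps)
qed

lemma psi_1: "psi u 1 = of_real (1 - c * u\<^sup>2)"
proof -
  have "Y 1 \<omega> = 1" for \<omega> using S1_sq[of \<omega>] by (simp add: Y_def Z_def)
  then show ?thesis by (simp add: psi_def phi_def gam_def N_def prob_space)
qed

text \<open>The factors \<open>exp (- (c * u^2 / (k + 1)))\<close> are at most 1, so errors of
  earlier steps are never amplified and the one-step errors just add up.\<close>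

lemma psi_approx:
  assumes "1 \<le> n" and u: "\<bar>u\<bar> \<le> 1"
  shows "cmod (psi u n - of_real (exp (- (c * u\<^sup>2 * harm n))))
    \<le> C\<^sup>2 * u\<^sup>2 + 14 * C^4 * (\<Sum>k=1..<n. \<bar>u\<bar>^3 / real k + u\<^sup>2 / (real k)\<^sup>2)"
  using assms(1)
proof (induction n rule: nat_induct_at_least)
  \<comment> \<open>\<open>Y 1 = 1\<close> makes \<open>psi u 1 = 1 - c * u^2\<close>, the
    linearisation of the factor belonging to \<open>harm 1 = 1\<close>; hence the exponent carries
    the full \<open>harm n\<close>.\<close>
  case base
  let ?x = "c * u\<^sup>2"
  have "cmod (psi u 1 - of_real (exp (- ?x))) = \<bar>exp (- ?x) - (1 - ?x)\<bar>"
    unfolding psi_1 by (simp flip: of_real_diff add: abs_minus_commute del: of_real_diff)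
  also have "\<dots> \<le> ?x\<^sup>2 / 2"
    using c_pos by (intro abs_exp_minus_le) auto
  also have "\<dots> \<le> (C / 2 * u\<^sup>2)\<^sup>2 / 2"
    using c_pos cu_le by (intro divide_right_mono power_mono) auto
  also have "\<dots> = C\<^sup>2 / 8 * u^4" by (simp add: power_mult_distrib power_divide)
  also have "\<dots> \<le> C\<^sup>2 * u\<^sup>2" by (intro mult_mono power4_le u) auto
  finally show ?case by (simp add: harm_expand)
next
  case (Suc n)
  let ?x = "c * u\<^sup>2" and ?s = "real (Suc n)"
  let ?q = "exp (- (?x / ?s))"
  have q: "exp (- (?x * harm (Suc n))) = ?q * exp (- (?x * harm n))"
    by (simp add: harm_Suc distrib_left divide_inverse flip: exp_add)
  have "psi u (Suc n) - of_real (exp (- (?x * harm (Suc n)))) =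
      (psi u (Suc n) - of_real ?q * psi u n) + of_real ?q * (psi u n - of_real (exp (- (?x * harm n))))"
    unfolding q by (simp add: algebra_simps)
  then have "cmod (psi u (Suc n) - of_real (exp (- (?x * harm (Suc n))))) \<le>
      cmod (psi u (Suc n) - of_real ?q * psi u n) + cmod (of_real ?q * (psi u n - of_real (exp (- (?x * harm n)))))"
    by (simp only: norm_triangle_ineq)
  also have "cmod (of_real ?q * (psi u n - of_real (exp (- (?x * harm n))))) \<le>
      1 * cmod (psi u n - of_real (exp (- (?x * harm n))))"
    unfolding norm_mult using c_pos by (intro mult_right_mono) auto
  finally have "cmod (psi u (Suc n) - of_real (exp (- (?x * harm (Suc n))))) \<le>
     14 * C^4 * (\<bar>u\<bar>^3 / real n + u\<^sup>2 / (real n)\<^sup>2) +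
      (C\<^sup>2 * u\<^sup>2 + 14 * C^4 * (\<Sum>k=1..<n. \<bar>u\<bar>^3 / real k + u\<^sup>2 / (real k)\<^sup>2))"
    using psi_exp_step[OF Suc(1) u] Suc(2) by linarith
  also have "\<dots> = C\<^sup>2 * u\<^sup>2 + 14 * C^4 * (\<Sum>k=1..<Suc n. \<bar>u\<bar>^3 / real k + u\<^sup>2 / (real k)\<^sup>2)"
    using Suc(1) by (simp add: sum.atLeastLessThan_Suc distrib_left del: sum.op_ivl_Suc)
  finally show ?case .
qed

text \<open>Since \<open>gam\<close> is bounded uniformly in \<open>n\<close>, undoing the
  correction costs only a multiple of \<open>u^2\<close>.\<close>

lemma phi_approx:
  assumes n: "1 \<le> n" and u: "\<bar>u\<bar> \<le> 1"
  shows "cmod (phi u n - of_real (exp (- (c * u\<^sup>2 * harm n)))) \<le> 30 * C^4 * (\<bar>u\<bar>^3 * harm n + u\<^sup>2)"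
proof -
  have "(\<Sum>k=1..<n. \<bar>u\<bar>^3 / real k + u\<^sup>2 / (real k)\<^sup>2) =
      \<bar>u\<bar>^3 * (\<Sum>k=1..<n. 1 / real k) + u\<^sup>2 * (\<Sum>k=1..<n. 1 / (real k)\<^sup>2)"
    by (simp add: sum.distrib sum_distrib_left)
  also have "\<dots> \<le> \<bar>u\<bar>^3 * harm n + u\<^sup>2 * 2"
  proof (intro add_mono mult_left_mono sum_inverse_squares_le)
    show "(\<Sum>k=1..<n. 1 / real k) \<le> harm n"
      unfolding harm_def by (simp add: divide_inverse, intro sum_mono2) auto
  qed auto
  finally have sum: "(\<Sum>k=1..<n. \<bar>u\<bar>^3 / real k + u\<^sup>2 / (real k)\<^sup>2) \<le> \<bar>u\<bar>^3 * harm n + u\<^sup>2 * 2" .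
  have C: "1 \<le> C^4" "C\<^sup>2 \<le> C^4" using C_ge_1 by (auto intro: power_increasing)
  have "phi u n - of_real (exp (- (c * u\<^sup>2 * harm n))) =
     (psi u n - of_real (exp (- (c * u\<^sup>2 * harm n)))) + of_real (c * u\<^sup>2) * gam u n"
    by (simp add: psi_def)
  then have "cmod (phi u n - of_real (exp (- (c * u\<^sup>2 * harm n)))) \<le>
     cmod (psi u n - of_real (exp (- (c * u\<^sup>2 * harm n)))) + cmod (of_real (c * u\<^sup>2) * gam u n)"
    by (simp only: norm_triangle_ineq)
  also have "\<dots> \<le> (C\<^sup>2 * u\<^sup>2 + 14 * C^4 * (\<bar>u\<bar>^3 * harm n + u\<^sup>2 * 2)) + C / 2 * u\<^sup>2 * C"
  proof (rule add_mono)
    show "cmod (psi u n - of_real (exp (- (c * u\<^sup>2 * harm n)))) \<le> C\<^sup>2 * u\<^sup>2 + 14 * C^4 * (\<bar>u\<bar>^3 * harm n + u\<^sup>2 * 2)"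
      by (rule order_trans[OF psi_approx[OF n u]]) (intro add_left_mono mult_left_mono sum, simp)
    show "cmod (of_real (c * u\<^sup>2) * gam u n) \<le> C / 2 * u\<^sup>2 * C"
      unfolding norm_mult norm_of_real using c_pos C_pos cu_le
      by (intro mult_mono norm_gam_le n) auto
  qed
  also have "\<dots> = 3 / 2 * (C\<^sup>2 * u\<^sup>2) + 14 * (C^4 * (\<bar>u\<bar>^3 * harm n)) + 28 * (C^4 * u\<^sup>2)"
    by (simp add: algebra_simps power2_eq_square)
  also have "\<dots> \<le> 2 * (C^4 * u\<^sup>2) + 30 * (C^4 * (\<bar>u\<bar>^3 * harm n)) + 28 * (C^4 * u\<^sup>2)"
    by (intro add_mono mult_mono C order_refl) (use C_pos harm_nonneg[of n, where ?'a = real] in auto)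
  finally show ?thesis by (simp add: algebra_simps)
qed

end

section \<open>Limit theorems and coverage\<close>

lemma erw_estimator_measurable:
  assumes "\<And>k. 1 \<le> k \<Longrightarrow> X k \<in> borel_measurable M"
  shows "erw_estimator X n \<in> borel_measurable M"
proof -
  have S: "erw_position X k \<in> borel_measurable M" for k
    unfolding erw_position_def[abs_def] by (intro borel_measurable_sum) (use assms in auto)
  show ?thesis
    unfolding erw_estimator_def[abs_def]
    by (intro borel_measurable_divide borel_measurable_times borel_measurable_sum borel_measurable_add
        borel_measurable_power borel_measurable_const S assms) auto
qed

lemma erw_coverage_event:
  assumes "\<And>k. 1 \<le> k \<Longrightarrow> X k \<in> borel_measurable M"
  shows "{\<omega> \<in> space M. p \<in> erw_confidence_interval X \<alpha> n \<omega>} \<in> sets M"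
proof -
  have [measurable]: "erw_estimator X n \<in> borel_measurable M"
    by (rule erw_estimator_measurable) (use assms in auto)
  show ?thesis
    unfolding erw_confidence_interval_def erw_half_width_def atLeastAtMost_iff by measurable
qed

lemma tendsto_harm_pred_over_ln: "(\<lambda>n. harm (n - 1) / ln (real n)) \<longlonglongrightarrow> 1"
proof -
  have "(\<lambda>n. harm n / ln (real n) - inverse (real n) / ln (real n)) \<longlonglongrightarrow> 1 - 0"
    by (intro tendsto_diff harm_over_ln tendsto_divide_0[OF lim_inverse_n filterlim_ln_real_at_infinity])
  moreover have "eventually (\<lambda>n. harm n / ln (real n) - inverse (real n) / ln (real n) = harm (n - 1) / ln (real n)) sequentially"
    using eventually_gt_at_top[of 0]
  proof eventually_elim
    case (elim n)
    then show ?case by (cases n) (simp_all add: harm_Suc flip: diff_divide_distrib)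
  qed
  ultimately show ?thesis by (simp add: tendsto_cong)
qed

section \<open>Central limit theorem for the martingale\<close>

context erw_martingale
begin

definition W :: "nat \<Rightarrow> 'a \<Rightarrow> real" where
  "W n \<omega> = sqrt (1 - 2 * a) * N n \<omega> / sqrt (ln (real n))"

lemma W_measurable [measurable]: "W n \<in> borel_measurable M"
  and N_measurable [measurable]: "N n \<in> borel_measurable M"
  and V_measurable [measurable]: "V n \<in> borel_measurable M"
proof -
  show N: "N n \<in> borel_measurable M" "V n \<in> borel_measurable M"
    using bdd_M[OF bdd_N] bdd_M[OF bdd_V] by (auto simp: bdd_measurable_def)
  show "W n \<in> borel_measurable M" unfolding W_def[abs_def] using N by measurable
qed

text \<open>The characteristic function of \<open>W n\<close> at \<open>t\<close> is
  \<open>phi (u n) n\<close> with \<open>u n\<close> of order \<open>1 / sqrt (ln n)\<close>. Then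
  \<open>(u n)^2 * harm n\<close> has a limit while the error of \<open>phi_approx\<close> vanishes;
  \<open>c\<close> and the factor \<open>sqrt (1 - 2 * a)\<close> combine to the exponent
  \<open>t^2 / 2\<close>.\<close>

lemma W_clt: "weak_conv_m (\<lambda>n. distr M borel (W n)) std_normal_distribution"
proof (rule levy_continuity)
  show "real_distribution (distr M borel (W n))" for n
    by (rule real_distribution_distr) measurable
  show "real_distribution std_normal_distribution" by (rule real_dist_normal_dist)
  fix t :: real
  define u where "u n = t * sqrt (1 - 2 * a) / sqrt (ln (real n))" for n
  have char: "char (distr M borel (W n)) t = phi (u n) n" for n
    unfolding char_def phi_def by (subst integral_distr) (auto simp: W_def u_def mult.assoc)
  have "filterlim (\<lambda>n. sqrt (ln (real n))) at_infinity sequentially"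
    by (intro filterlim_at_top_imp_at_infinity filterlim_compose[OF sqrt_at_top]
        filterlim_compose[OF ln_at_top filterlim_real_sequentially])
  then have u: "u \<longlonglongrightarrow> 0"
    unfolding u_def by (intro tendsto_divide_0[OF tendsto_const])
  have u_harm: "eventually (\<lambda>n. t\<^sup>2 * (1 - 2 * a) * (harm n / ln (real n)) = (u n)\<^sup>2 * harm n) sequentially"
    using eventually_gt_at_top[of 1]
    by eventually_elim (use a_less in \<open>simp add: u_def power_mult_distrib power_divide\<close>)
  have "(\<lambda>n. t\<^sup>2 * (1 - 2 * a) * (harm n / ln (real n))) \<longlonglongrightarrow> t\<^sup>2 * (1 - 2 * a) * 1"
    by (intro tendsto_mult tendsto_const harm_over_ln)
  then have uh: "(\<lambda>n. (u n)\<^sup>2 * harm n) \<longlonglongrightarrow> t\<^sup>2 * (1 - 2 * a)"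
    using u_harm by (simp add: tendsto_cong)
  have "(\<lambda>n. exp (- (c * ((u n)\<^sup>2 * harm n)))) \<longlonglongrightarrow> exp (- (c * (t\<^sup>2 * (1 - 2 * a))))"
    by (intro tendsto_exp tendsto_minus tendsto_mult tendsto_const uh)
  moreover have "c * (t\<^sup>2 * (1 - 2 * a)) = t\<^sup>2 / 2"
    using a_less by (simp add: c_def divide_simps)
  ultimately have lim: "(\<lambda>n. complex_of_real (exp (- (c * (u n)\<^sup>2 * harm n)))) \<longlonglongrightarrow> complex_of_real (exp (- t\<^sup>2 / 2))"
    by (intro tendsto_of_real) (simp add: mult.assoc)
  \<comment> \<open>The cubic error is split as \<open>|u n|\<close> times the convergent
    \<open>(u n)^2 * harm n\<close>, so the first factor sends it to 0.\<close>
  have "(\<lambda>n. 30 * C^4 * (\<bar>u n\<bar> * ((u n)\<^sup>2 * harm n) + (u n)\<^sup>2)) \<longlonglongrightarrow> 30 * C^4 * (\<bar>0\<bar> * (t\<^sup>2 * (1 - 2 * a)) + 0\<^sup>2)"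
    by (intro tendsto_intros u uh)
  then have err: "(\<lambda>n. 30 * C^4 * (\<bar>u n\<bar> * ((u n)\<^sup>2 * harm n) + (u n)\<^sup>2)) \<longlonglongrightarrow> 0" by simp
  have "eventually (\<lambda>n. \<bar>u n\<bar> < 1) sequentially"
    using order_tendstoD(2)[OF tendsto_rabs[OF u], of 1] by simp
  then have "eventually (\<lambda>n. norm (phi (u n) n - complex_of_real (exp (- (c * (u n)\<^sup>2 * harm n))))
      \<le> 30 * C^4 * (\<bar>u n\<bar> * ((u n)\<^sup>2 * harm n) + (u n)\<^sup>2)) sequentially"
    using eventually_ge_at_top[of 1]
  proof eventually_elim
    case (elim n)
    have eq: "\<bar>u n\<bar> * ((u n)\<^sup>2 * harm n) = \<bar>u n\<bar>^3 * harm n"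
      by (simp add: power3_eq_cube power2_eq_square mult.assoc)
    show ?case unfolding eq using elim by (intro phi_approx) auto
  qed
  then have "(\<lambda>n. phi (u n) n - complex_of_real (exp (- (c * (u n)\<^sup>2 * harm n)))) \<longlonglongrightarrow> 0"
    by (rule Lim_null_comparison[OF _ err])
  from tendsto_add[OF this lim]
  show "(\<lambda>n. char (distr M borel (W n)) t) \<longlonglongrightarrow> char std_normal_distribution t"
    by (simp add: char char_std_normal_distribution)
qed

text \<open>The normal law has no atoms, so the two boundary points of the interval are null and
  weak convergence passes to its probability.\<close>

lemma W_interval_limit:
  assumes "0 < y"
  shows "(\<lambda>n. prob {\<omega> \<in> space M. \<bar>W n \<omega>\<bar> \<le> y}) \<longlonglongrightarrow>
    cdf std_normal_distribution y - cdf std_normal_distribution (- y)"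
proof -
  interpret std: real_distribution std_normal_distribution by (rule real_dist_normal_dist)
  have fr: "frontier {- y..y} = {y, - y}"
    using assms by (auto simp: frontier_def)
  have "emeasure std_normal_distribution (frontier {- y..y}) = 0"
    unfolding fr std.emeasure_eq_measure
    using std.finite_measure_Union[of "{- y}" "{y}"] assms by (simp add: measure_std_normal_singleton)
  then have "(\<lambda>n. measure (distr M borel (W n)) {- y..y}) \<longlonglongrightarrow> measure std_normal_distribution {- y..y}"
    by (intro weak_conv_imp_continuity_set_conv[OF _ _ W_clt] real_dist_normal_dist real_distribution_distr) auto
  moreover have "measure (distr M borel (W n)) {- y..y} = prob {\<omega> \<in> space M. \<bar>W n \<omega>\<bar> \<le> y}" for n
    by (subst measure_distr) (auto intro!: arg_cong[where f = prob])
  moreover have "measure std_normal_distribution {- y..y} =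
      cdf std_normal_distribution y - cdf std_normal_distribution (- y)"
  proof -
    have "{- y..y} = {- y} \<union> {- y<..y}" using assms by auto
    also have "measure std_normal_distribution \<dots> =
        measure std_normal_distribution {- y} + measure std_normal_distribution {- y<..y}"
      by (rule std.finite_measure_Union) auto
    finally show ?thesis
      using std.cdf_diff_eq[of "- y" y] assms by (simp add: measure_std_normal_singleton)
  qed
  ultimately show ?thesis by simp
qed

section \<open>Logarithmic growth of the sum of squares\<close>

definition rest :: "nat \<Rightarrow> 'a \<Rightarrow> real" where
  "rest n \<omega> = (1 - 2 * a) * V n \<omega> - harm (n - 1) - 2 * N n \<omega>"

lemma rest_measurable [measurable]: "rest n \<in> borel_measurable M"
  unfolding rest_def[abs_def] by measurable

text \<open>Dividing \<open>(S (n + 1))^2\<close> by \<open>n\<close> instead of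
  \<open>n + 1\<close> removes the weight \<open>n / (n + 1)\<close> from the martingale part, which
  is then exactly \<open>2 * D n\<close>, so that \<open>N\<close> itself reappears. The price is
  that \<open>Y + Z^2\<close> telescopes in place of \<open>Y\<close>, with a leftover
  \<open>(Z (n + 1))^2 / n\<close> at each step. The constant 2 is the value of
  \<open>Y + Z^2\<close> at time 1.\<close>

lemma rest_eq:
  "rest (Suc m) \<omega> = 2 - Y (Suc m) \<omega> - (Z (Suc m) \<omega>)\<^sup>2 - (\<Sum>k=1..m. (Z (Suc k) \<omega>)\<^sup>2 / real k)"
proof (induction m)
  case 0
  show ?case using S1_sq[of \<omega>] by (simp add: rest_def V_def N_def harm_expand Y_def Z_def)
next
  case (Suc m)
  define n where "n = Suc m"
  have n: "1 \<le> n" by (simp add: n_def)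
  have "Y (Suc n) \<omega> + (Z (Suc n) \<omega>)\<^sup>2 + (Z (Suc n) \<omega>)\<^sup>2 / real n = (real (Suc n) * Z (Suc n) \<omega>)\<^sup>2 / real n"
    using n by (simp add: Y_def field_simps power2_eq_square)
  also have "real (Suc n) * Z (Suc n) \<omega> = real n * Z n \<omega> + X (Suc n) \<omega>"
    using n by (simp add: Z_def S_Suc)
  also have "(\<dots>)\<^sup>2 / real n = Y n \<omega> + 2 * (Z n \<omega> * X (Suc n) \<omega>) + 1 / real n"
    using n by (simp add: power2_sum add_divide_distrib Y_def) (simp add: power2_eq_square)
  finally have step: "Y (Suc n) \<omega> + (Z (Suc n) \<omega>)\<^sup>2 + (Z (Suc n) \<omega>)\<^sup>2 / real n =
      Y n \<omega> + 2 * (Z n \<omega> * X (Suc n) \<omega>) + 1 / real n" .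
  have D: "D n \<omega> = Z n \<omega> * X (Suc n) \<omega> - a * (Z n \<omega>)\<^sup>2"
    by (simp add: D_def algebra_simps power2_eq_square)
  have "harm n = harm m + 1 / real n" by (simp add: n_def harm_Suc divide_inverse)
  then have "rest (Suc n) \<omega> = rest n \<omega> + (1 - 2 * a) * (Z n \<omega>)\<^sup>2 - 1 / real n - 2 * D n \<omega>"
    by (simp add: rest_def V_Suc[OF n] N_Suc[OF n] distrib_left) (simp add: n_def)
  also have "\<dots> = rest n \<omega> + (Z n \<omega>)\<^sup>2 + Y n \<omega> - (Y (Suc n) \<omega> + (Z (Suc n) \<omega>)\<^sup>2 + (Z (Suc n) \<omega>)\<^sup>2 / real n)"
    unfolding step D by (simp add: algebra_simps)
  finally show ?case
    using Suc by (simp add: n_def)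
qed

text \<open>Apart from the constant, all terms of \<open>rest_eq\<close> have one sign, so their
  means bound the mean absolute value; the leftovers have means at most \<open>C / k^2\<close> and
  sum to at most \<open>2 * C\<close>.\<close>

lemma rest_mean_le:
  assumes "1 \<le> n"
  shows "expectation (\<lambda>\<omega>. \<bar>rest n \<omega>\<bar>) \<le> 6 * C"
proof -
  obtain m where m: "n = Suc m" using assms by (cases n) auto
  let ?b = "\<lambda>\<omega>. 2 + Y n \<omega> + (Z n \<omega>)\<^sup>2 + (\<Sum>k=1..m. (Z (Suc k) \<omega>)\<^sup>2 / real k)"
  have bdd_rest: "bdd_measurable M (rest n)"
    unfolding rest_def[abs_def] by (intro bdd_intros)
  have "expectation (\<lambda>\<omega>. \<bar>rest n \<omega>\<bar>) \<le> expectation ?b"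
  proof (intro integral_mono int_intros' bdd_rest)
    fix \<omega>
    have "0 \<le> Y n \<omega>" "0 \<le> (\<Sum>k=1..m. (Z (Suc k) \<omega>)\<^sup>2 / real k)"
      by (auto simp: Y_def intro!: sum_nonneg)
    then show "\<bar>rest n \<omega>\<bar> \<le> ?b \<omega>"
      unfolding m rest_eq using zero_le_power2[of "Z (Suc m) \<omega>"] by linarith
  qed
  also have "expectation ?b = expectation (\<lambda>_. 2) + expectation (Y n) + expectation (\<lambda>\<omega>. (Z n \<omega>)\<^sup>2)
      + (\<Sum>k=1..m. expectation (\<lambda>\<omega>. (Z (Suc k) \<omega>)\<^sup>2 / real k))"
    by (intro expectation_intros has_bochner_integral_sum)
  also have "\<dots> \<le> 2 + C + C / real n + (\<Sum>k=1..m. C * (1 / (real k)\<^sup>2))"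
  proof (intro add_mono Y_mean_le Z_sq_le sum_mono assms)
    fix k assume k: "k \<in> {1..m}"
    have "expectation (\<lambda>\<omega>. (Z (Suc k) \<omega>)\<^sup>2) \<le> C / real (Suc k)" by (rule Z_sq_le) simp
    also have "\<dots> \<le> C / real k" using k C_pos by (intro divide_left_mono) auto
    finally have "expectation (\<lambda>\<omega>. (Z (Suc k) \<omega>)\<^sup>2) / real k \<le> C / real k / real k"
      by (rule divide_right_mono) simp
    then show "expectation (\<lambda>\<omega>. (Z (Suc k) \<omega>)\<^sup>2 / real k) \<le> C * (1 / (real k)\<^sup>2)"
      by (simp add: power2_eq_square)
  qed (simp add: prob_space)
  also have "\<dots> \<le> 2 * C + C + C + C * 2"
  proof (intro add_mono)
    have "(\<Sum>k=1..m. 1 / (real k)\<^sup>2) \<le> 2"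
      using sum_inverse_squares_le[of "Suc m"] by (simp add: atLeastLessThanSuc_atLeastAtMost)
    then show "(\<Sum>k=1..m. C * (1 / (real k)\<^sup>2)) \<le> C * 2"
      unfolding sum_distrib_left[symmetric] using C_pos by (intro mult_left_mono) auto
    show "C / real n \<le> C" using C_pos assms by (simp add: field_simps)
  qed (use C_ge_1 in auto)
  finally show ?thesis by simp
qed

lemma rest_over_ln_null:
  assumes "0 < e"
  shows "(\<lambda>n. prob {\<omega> \<in> space M. e \<le> \<bar>rest n \<omega> / ln (real n)\<bar>}) \<longlonglongrightarrow> 0"
proof (rule tendsto_sandwich[where f = "\<lambda>_. 0"])
  have "eventually (\<lambda>n. 1 < n) sequentially" by (rule eventually_gt_at_top)
  then show "eventually (\<lambda>n. prob {\<omega> \<in> space M. e \<le> \<bar>rest n \<omega> / ln (real n)\<bar>} \<le> 6 * C / e / ln (real n)) sequentially"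
  proof eventually_elim
    case (elim n)
    then have L: "0 < ln (real n)" by simp
    have bdd_rest: "bdd_measurable M (rest n)"
      unfolding rest_def[abs_def] by (intro bdd_intros)
    have "{\<omega> \<in> space M. e \<le> \<bar>rest n \<omega> / ln (real n)\<bar>} = {\<omega> \<in> space M. e * ln (real n) \<le> \<bar>rest n \<omega>\<bar>}"
      using L by (simp add: field_simps)
    also have "prob \<dots> \<le> expectation (\<lambda>\<omega>. \<bar>rest n \<omega>\<bar>) / (e * ln (real n))"
      by (rule integral_Markov_inequality_measure[where A = "{}"])
        (use L assms in \<open>auto intro!: int_intros bdd_rest\<close>)
    also have "\<dots> \<le> 6 * C / (e * ln (real n))"
      using L assms elim by (intro divide_right_mono rest_mean_le) auto
    finally show ?case by simp
  qed
  show "(\<lambda>n. 6 * C / e / ln (real n)) \<longlonglongrightarrow> 0"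
    by (intro tendsto_divide_0[OF tendsto_const] filterlim_ln_real_at_infinity)
qed auto

text \<open>Chebyshev's inequality: a second moment of order \<open>ln n\<close> is divided by
  \<open>(e * ln n)^2\<close>.\<close>

lemma N_over_ln_null:
  assumes "0 < e"
  shows "(\<lambda>n. prob {\<omega> \<in> space M. e \<le> \<bar>N n \<omega> / ln (real n)\<bar>}) \<longlonglongrightarrow> 0"
proof (rule tendsto_sandwich[where f = "\<lambda>_. 0"])
  have "eventually (\<lambda>n. 1 < n) sequentially" by (rule eventually_gt_at_top)
  then show "eventually (\<lambda>n. prob {\<omega> \<in> space M. e \<le> \<bar>N n \<omega> / ln (real n)\<bar>}
      \<le> 4 * C / e\<^sup>2 * (harm (n - 1) / ln (real n)) / ln (real n)) sequentially"
  proof eventually_elim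
    case (elim n)
    then have L: "0 < ln (real n)" by simp
    have eq: "e \<le> \<bar>N n \<omega> / ln (real n)\<bar> \<longleftrightarrow> (e * ln (real n))\<^sup>2 \<le> (N n \<omega>)\<^sup>2" for \<omega>
    proof -
      have "e \<le> \<bar>N n \<omega> / ln (real n)\<bar> \<longleftrightarrow> \<bar>e * ln (real n)\<bar> \<le> \<bar>N n \<omega>\<bar>"
        using L assms by (simp add: field_simps abs_mult)
      then show ?thesis by (simp add: abs_le_square_iff)
    qed
    have "prob {\<omega> \<in> space M. e \<le> \<bar>N n \<omega> / ln (real n)\<bar>} \<le> expectation (\<lambda>\<omega>. (N n \<omega>)\<^sup>2) / (e * ln (real n))\<^sup>2"
      unfolding eq
      by (rule integral_Markov_inequality_measure[where A = "{}"])
        (use L assms in \<open>auto intro!: int_intros\<close>)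
    also have "\<dots> \<le> 4 * C * harm (n - 1) / (e * ln (real n))\<^sup>2"
      using N_sq_le[of "n - 1"] elim by (intro divide_right_mono) auto
    finally show ?case by (simp add: power2_eq_square mult_ac)
  qed
  show "(\<lambda>n. 4 * C / e\<^sup>2 * (harm (n - 1) / ln (real n)) / ln (real n)) \<longlonglongrightarrow> 0"
    by (intro tendsto_divide_0[OF tendsto_mult[OF tendsto_const tendsto_harm_pred_over_ln]] filterlim_ln_real_at_infinity)
qed auto

section \<open>The confidence interval in terms of the martingale\<close>

lemma erw_estimator_eq:
  assumes "a = 2 * p - 1" "2 \<le> n" "V n \<omega> \<noteq> 0"
  shows "erw_estimator X n \<omega> = p + N n \<omega> / (2 * V n \<omega>)"
proof -
  have set: "{1..n-1} = {1..<n}" using assms(2) by auto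
  have "erw_estimator X n \<omega> = (\<Sum>k=1..<n. Z k \<omega> * (X (Suc k) \<omega> + Z k \<omega>)) / (2 * V n \<omega>)"
    unfolding erw_estimator_def set V_def Z_def by simp
  also have "(\<Sum>k=1..<n. Z k \<omega> * (X (Suc k) \<omega> + Z k \<omega>)) = (\<Sum>k=1..<n. D k \<omega> + 2 * p * (Z k \<omega>)\<^sup>2)"
  proof (intro sum.cong refl)
    \<comment> \<open>Hence \<open>X + Z = (X - a * Z) + 2 * p * Z\<close>: the numerator of the
      estimator splits into the martingale and \<open>2 * p * V\<close>.\<close>
    have p: "2 * p = 1 + a" using assms(1) by simp
    show "Z k \<omega> * (X (Suc k) \<omega> + Z k \<omega>) = D k \<omega> + 2 * p * (Z k \<omega>)\<^sup>2" for k
      unfolding D_def p by (simp add: algebra_simps power2_eq_square)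
  qed
  also have "\<dots> = N n \<omega> + 2 * p * V n \<omega>"
    by (simp add: N_def V_def sum.distrib sum_distrib_left)
  finally show ?thesis using assms(3) by (simp add: add_divide_distrib)
qed

text \<open>Membership says that the estimation error is at most the half width in absolute value;
  multiplying by the positive number \<open>2 * s * V n / sqrt L\<close> turns the left side into
  \<open>|W n|\<close>. The right side then depends only on \<open>V n / ln n\<close> and
  \<open>N n / ln n\<close>, both of which converge. No sign of the root's argument enters: if the
  half width is negative, both sides are false.\<close>

lemma mem_confidence_interval_iff:
  fixes \<alpha> :: real
  defines "\<tau> \<equiv> quantile std_normal_distribution (1 - \<alpha> / 2)"
  assumes a: "a = 2 * p - 1" and n: "2 \<le> n" and V: "0 < V n \<omega>"
  shows "p \<in> erw_confidence_interval X \<alpha> n \<omega> \<longleftrightarrow>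
    \<bar>W n \<omega>\<bar> \<le> sqrt (1 - 2 * a) * (V n \<omega> / ln (real n)) *
      sqrt (1 - 2 * a - 2 * (N n \<omega> / ln (real n)) / (V n \<omega> / ln (real n))) * \<tau>"
proof -
  define L where "L = ln (real n)"
  define s where "s = sqrt (1 - 2 * a)"
  define h where "h = sqrt (1 - 2 * a - 2 * (N n \<omega> / V n \<omega>))"
  have L: "0 < L" "0 < sqrt L" using n by (auto simp: L_def)
  have s: "0 < s" using a_less by (simp add: s_def)
  have est: "erw_estimator X n \<omega> = p + N n \<omega> / (2 * V n \<omega>)"
    using a n V by (intro erw_estimator_eq) auto
  have hw: "erw_half_width X \<alpha> n \<omega> = h / (2 * sqrt L) * \<tau>"
    unfolding erw_half_width_def est h_def L_def \<tau>_def using V by (simp add: a field_simps)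
  have "p \<in> {p + x - w..p + x + w} \<longleftrightarrow> \<bar>x\<bar> \<le> w" for x w :: real by auto
  then have "p \<in> erw_confidence_interval X \<alpha> n \<omega> \<longleftrightarrow> \<bar>N n \<omega> / (2 * V n \<omega>)\<bar> \<le> h / (2 * sqrt L) * \<tau>"
    unfolding erw_confidence_interval_def hw est .
  also have "\<dots> \<longleftrightarrow> (2 * s * V n \<omega> / sqrt L) * \<bar>N n \<omega> / (2 * V n \<omega>)\<bar> \<le> (2 * s * V n \<omega> / sqrt L) * (h / (2 * sqrt L) * \<tau>)"
    using s V L by (subst mult_le_cancel_left_pos) auto
  also have "(2 * s * V n \<omega> / sqrt L) * \<bar>N n \<omega> / (2 * V n \<omega>)\<bar> = \<bar>W n \<omega>\<bar>"
    using s V L unfolding W_def s_def[symmetric] L_def[symmetric] by (simp add: abs_mult)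
  also have "(2 * s * V n \<omega> / sqrt L) * (h / (2 * sqrt L) * \<tau>) = s * (V n \<omega> / L) * h * \<tau>"
    using L by simp
  also have "h = sqrt (1 - 2 * a - 2 * (N n \<omega> / L) / (V n \<omega> / L))"
    unfolding h_def using L by simp
  finally show ?thesis unfolding s_def L_def .
qed

text \<open>The random bound for \<open>|W n|\<close> is a function \<open>h\<close>, continuous at
  the limit point \<open>(v0, 0)\<close> with value \<open>\<tau>\<close>. Off two rare events it
  lies within \<open>d\<close> of \<open>\<tau>\<close>, so the coverage event is sandwiched between
  \<open>|W n| \<le> \<tau> - d\<close> and \<open>|W n| \<le> \<tau> + d\<close>.\<close>

lemma confidence_interval_coverage:
  assumes a: "a = 2 * p - 1" and \<alpha>: "0 < \<alpha>" "\<alpha> < 1"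
  shows "(\<lambda>n. prob {\<omega> \<in> space M. p \<in> erw_confidence_interval X \<alpha> n \<omega>}) \<longlonglongrightarrow> 1 - \<alpha>"
proof (rule tendstoI)
  fix e :: real
  assume e: "0 < e"
  define \<tau> where "\<tau> = quantile std_normal_distribution (1 - \<alpha> / 2)"
  define G where "G y = cdf std_normal_distribution y - cdf std_normal_distribution (- y)" for y
  define s where "s = sqrt (1 - 2 * a)"
  define v0 where "v0 = 1 / (1 - 2 * a)"
  define h where "h z = s * fst z * sqrt (1 - 2 * a - 2 * snd z / fst z) * \<tau>" for z :: "real \<times> real"
  have \<tau>: "0 < \<tau>" using \<alpha> by (simp add: \<tau>_def quantile_std_normal_pos)
  have v0: "0 < v0" using a_less by (simp add: v0_def)
  have s: "s * s = 1 - 2 * a" using a_less by (simp add: s_def)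
  have "cdf std_normal_distribution \<tau> = 1 - \<alpha> / 2"
    unfolding \<tau>_def using \<alpha> by (intro cdf_quantile_std_normal) auto
  then have G\<tau>: "G \<tau> = 1 - \<alpha>" by (simp add: G_def cdf_std_normal_uminus)
  have "isCont (\<lambda>y. cdf std_normal_distribution (- y)) \<tau>"
    by (rule isCont_o2[of _ uminus]) (auto intro: isCont_cdf_std_normal)
  then have "isCont G \<tau>"
    unfolding G_def[abs_def] by (intro isCont_diff isCont_cdf_std_normal)
  then obtain d0 where d0: "0 < d0" "\<And>y. \<bar>y - \<tau>\<bar> < d0 \<Longrightarrow> \<bar>G y - G \<tau>\<bar> < e / 4"
    using e unfolding continuous_at_eps_delta dist_real_def by (meson divide_pos_pos zero_less_numeral)
  define d where "d = min (d0 / 2) (\<tau> / 2)"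
  have d: "0 < d" "d < d0" "d < \<tau>" using d0 \<tau> by (auto simp: d_def)
  have "isCont h (v0, 0)"
    unfolding h_def[abs_def] using v0 by (intro continuous_intros) auto
  then obtain r where r: "0 < r" "\<And>z. dist z (v0, 0) < r \<Longrightarrow> \<bar>h z - h (v0, 0)\<bar> < d"
    using d(1) unfolding continuous_at_eps_delta dist_real_def by meson
  have "h (v0, 0) = (s * s) * v0 * \<tau>" by (simp add: h_def s_def)
  then have h0: "h (v0, 0) = \<tau>" unfolding s v0_def using a_less by simp
  define x where "x n \<omega> = N n \<omega> / ln (real n)" for n \<omega>
  define v where "v n \<omega> = V n \<omega> / ln (real n)" for n \<omega>
  \<comment> \<open>\<open>k\<close> bounds the deviations of \<open>harm (n - 1) / ln n\<close>,
    \<open>N n / ln n\<close> and \<open>rest n / ln n\<close>. They enter \<open>v n - v0\<close>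
    with weights 1, 2 and 1 times \<open>v0\<close>, whence \<open>v0 * (4 * k)\<close>. Capping
    \<open>r'\<close> by \<open>v0\<close> keeps \<open>V n\<close> positive, as
    \<open>mem_confidence_interval_iff\<close> demands.\<close>
  define r' where "r' = min r v0"
  define k where "k = min (r' / 2) (r' / (8 * v0))"
  have r': "0 < r'" "r' \<le> r" "r' \<le> v0" using r v0 by (auto simp: r'_def)
  have k: "0 < k" "k \<le> r' / 2" "v0 * (4 * k) \<le> r' / 2"
    using r' v0 by (auto simp: k_def min_def field_simps)
  let ?B1 = "\<lambda>n. {\<omega> \<in> space M. k \<le> \<bar>N n \<omega> / ln (real n)\<bar>}"
  let ?B2 = "\<lambda>n. {\<omega> \<in> space M. k \<le> \<bar>rest n \<omega> / ln (real n)\<bar>}"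
  let ?I = "\<lambda>n y. {\<omega> \<in> space M. \<bar>W n \<omega>\<bar> \<le> y}"
  let ?A = "\<lambda>n. {\<omega> \<in> space M. p \<in> erw_confidence_interval X \<alpha> n \<omega>}"
  have ev [measurable]: "?A n \<in> events" for n
    by (rule erw_coverage_event) (rule measurable_from_subalg[OF subalg X_adapted[OF _ order_refl]])
  have good: "\<bar>W n \<omega>\<bar> \<le> \<tau> - d \<Longrightarrow> p \<in> erw_confidence_interval X \<alpha> n \<omega>"
    "p \<in> erw_confidence_interval X \<alpha> n \<omega> \<Longrightarrow> \<bar>W n \<omega>\<bar> \<le> \<tau> + d"
    if n: "2 \<le> n" and H: "\<bar>harm (n - 1) / ln (real n) - 1\<bar> < k"
      and \<omega>: "\<bar>N n \<omega> / ln (real n)\<bar> < k" "\<bar>rest n \<omega> / ln (real n)\<bar> < k" for n \<omega>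
  proof -
    have L: "0 < ln (real n)" using n by simp
    have "(1 - 2 * a) * v n \<omega> = harm (n - 1) / ln (real n) + 2 * x n \<omega> + rest n \<omega> / ln (real n)"
      using L by (simp add: v_def x_def rest_def field_simps)
    then have "v n \<omega> = v0 * (harm (n - 1) / ln (real n) + 2 * x n \<omega> + rest n \<omega> / ln (real n))"
      using a_less by (simp add: v0_def field_simps)
    then have "v n \<omega> - v0 = v0 * ((harm (n - 1) / ln (real n) - 1) + 2 * x n \<omega> + rest n \<omega> / ln (real n))"
      by (simp add: algebra_simps)
    then have "\<bar>v n \<omega> - v0\<bar> = v0 * \<bar>(harm (n - 1) / ln (real n) - 1) + 2 * x n \<omega> + rest n \<omega> / ln (real n)\<bar>"
      using v0 by (simp add: abs_mult)
    also have "\<dots> < v0 * (4 * k)"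
      using H \<omega> v0 unfolding x_def by (intro mult_strict_left_mono) linarith+
    finally have vd: "\<bar>v n \<omega> - v0\<bar> < r' / 2" using k by linarith
    have xd: "\<bar>x n \<omega>\<bar> < r' / 2" using \<omega>(1) k(2) unfolding x_def by linarith
    have "dist (v n \<omega>, x n \<omega>) (v0, 0) \<le> \<bar>v n \<omega> - v0\<bar> + \<bar>x n \<omega>\<bar>"
      using sqrt_sum_squares_le_sum_abs[of "v n \<omega> - v0" "x n \<omega>"] by (simp add: dist_Pair_Pair dist_real_def)
    also have "\<dots> < r" using vd xd r' by linarith
    finally have hd: "\<bar>h (v n \<omega>, x n \<omega>) - \<tau>\<bar> < d" using r(2) h0 by metis
    have "0 < v n \<omega>" using vd r' by linarith
    then have V: "0 < V n \<omega>" using L by (simp add: v_def zero_less_divide_iff)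
    have iff: "p \<in> erw_confidence_interval X \<alpha> n \<omega> \<longleftrightarrow> \<bar>W n \<omega>\<bar> \<le> h (v n \<omega>, x n \<omega>)"
      unfolding mem_confidence_interval_iff[OF a n V] h_def s_def v_def x_def \<tau>_def by simp
    show "\<bar>W n \<omega>\<bar> \<le> \<tau> - d \<Longrightarrow> p \<in> erw_confidence_interval X \<alpha> n \<omega>"
      "p \<in> erw_confidence_interval X \<alpha> n \<omega> \<Longrightarrow> \<bar>W n \<omega>\<bar> \<le> \<tau> + d"
      unfolding iff using hd by linarith+
  qed
  have "eventually (\<lambda>n. \<bar>harm (n - 1) / ln (real n) - 1\<bar> < k) sequentially"
    using tendstoD[OF tendsto_harm_pred_over_ln k(1)] by (simp add: dist_real_def)
  moreover have "eventually (\<lambda>n. prob (?B1 n) < e / 4) sequentially"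
    using e by (intro order_tendstoD(2)[OF N_over_ln_null[OF k(1)]]) auto
  moreover have "eventually (\<lambda>n. prob (?B2 n) < e / 4) sequentially"
    using e by (intro order_tendstoD(2)[OF rest_over_ln_null[OF k(1)]]) auto
  moreover have "eventually (\<lambda>n. \<bar>prob (?I n (\<tau> - d)) - G (\<tau> - d)\<bar> < e / 4) sequentially"
    using tendstoD[OF W_interval_limit, of "\<tau> - d" "e / 4"] d e by (simp add: dist_real_def G_def)
  moreover have "eventually (\<lambda>n. \<bar>prob (?I n (\<tau> + d)) - G (\<tau> + d)\<bar> < e / 4) sequentially"
    using tendstoD[OF W_interval_limit, of "\<tau> + d" "e / 4"] d \<tau> e by (simp add: dist_real_def G_def)
  moreover have "eventually (\<lambda>n. 2 \<le> n) sequentially" by (rule eventually_ge_at_top)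
  ultimately show "eventually (\<lambda>n. dist (prob (?A n)) (1 - \<alpha>) < e) sequentially"
  proof eventually_elim
    case (elim n)
    have "?A n \<subseteq> ?I n (\<tau> + d) \<union> (?B1 n \<union> ?B2 n)"
      using good(2)[OF elim(6) elim(1)] by (auto simp: not_less[symmetric])
    then have "prob (?A n) \<le> prob (?I n (\<tau> + d) \<union> (?B1 n \<union> ?B2 n))"
      by (intro finite_measure_mono) measurable
    also have "\<dots> \<le> prob (?I n (\<tau> + d)) + prob (?B1 n \<union> ?B2 n)"
      by (rule measure_Un_le) measurable
    also have "prob (?B1 n \<union> ?B2 n) \<le> prob (?B1 n) + prob (?B2 n)"
      by (rule measure_Un_le) measurable
    finally have upper: "prob (?A n) \<le> prob (?I n (\<tau> + d)) + (prob (?B1 n) + prob (?B2 n))" by simp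
    have "?I n (\<tau> - d) \<subseteq> ?A n \<union> (?B1 n \<union> ?B2 n)"
      using good(1)[OF elim(6) elim(1)] by (auto simp: not_less[symmetric])
    then have "prob (?I n (\<tau> - d)) \<le> prob (?A n \<union> (?B1 n \<union> ?B2 n))"
      by (intro finite_measure_mono) measurable
    also have "\<dots> \<le> prob (?A n) + prob (?B1 n \<union> ?B2 n)"
      by (rule measure_Un_le) measurable
    also have "prob (?B1 n \<union> ?B2 n) \<le> prob (?B1 n) + prob (?B2 n)"
      by (rule measure_Un_le) measurable
    finally have lower: "prob (?I n (\<tau> - d)) \<le> prob (?A n) + (prob (?B1 n) + prob (?B2 n))" by simp
    \<comment> \<open>The four quarters of \<open>e\<close>: two bad events, the error of the limit
      theorem, and the change of \<open>G\<close> over distance \<open>d\<close>.\<close>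
    have "\<bar>G (\<tau> - d) - G \<tau>\<bar> < e / 4" "\<bar>G (\<tau> + d) - G \<tau>\<bar> < e / 4"
      using d0(2)[of "\<tau> - d"] d0(2)[of "\<tau> + d"] d(1,2) by simp_all
    with upper lower elim(2-5) show ?case
      unfolding dist_real_def G\<tau> by linarith
  qed
qed

end

section \<open>Reduction to steps that are everywhere 1 or -1\<close>

text \<open>Links \<open>choice_indep\<close>, a statement on sigma-algebras, to the product rule
  for independent variables: \<open>f\<close> and \<open>h\<close> generate sub-sigma-algebras of
  \<open>G\<close> and \<open>H\<close>.\<close>

lemma (in prob_space) expectation_mult_indep_set:
  fixes f h :: "'a \<Rightarrow> real"
  assumes indep: "indep_set (sets G) (sets H)"
    and sp: "space G = space M" "space H = space M"
    and f: "f \<in> borel_measurable G" "integrable M f"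
    and h: "h \<in> borel_measurable H" "integrable M h"
  shows "expectation (\<lambda>\<omega>. f \<omega> * h \<omega>) = expectation f * expectation h"
proof (rule indep_var_lebesgue_integral)
  have "sigma_sets (space M) {f -` A \<inter> space M |A. A \<in> sets borel} \<subseteq> sets G"
    using f(1) unfolding sp(1)[symmetric]
    by (intro sets.sigma_sets_subset) (auto intro: measurable_sets)
  moreover have "sigma_sets (space M) {h -` A \<inter> space M |A. A \<in> sets borel} \<subseteq> sets H"
    using h(1) unfolding sp(2)[symmetric]
    by (intro sets.sigma_sets_subset) (auto intro: measurable_sets)
  moreover have "f \<in> borel_measurable M" "h \<in> borel_measurable M"
    using f(2) h(2) by auto
  ultimately show "indep_var borel f borel h"
    using indep unfolding indep_var_eq indep_sets2_eq by (meson subset_iff order_trans)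
qed (use f h in auto)

context elephant_random_walk
begin

text \<open>A pointwise function of \<open>X k\<close>, hence still measurable with respect to the
  past, which repairs the values other than 1 and -1 that \<open>X k\<close> may take on a null
  set.\<close>

definition sign_step :: "nat \<Rightarrow> 'a \<Rightarrow> real" where
  "sign_step k \<omega> = (if X k \<omega> = 1 then 1 else -1)"

text \<open>Generated by the original steps, not by \<open>sign_step\<close>, so that
  \<open>choice_indep\<close> applies literally.\<close>

definition past :: "nat \<Rightarrow> 'a measure" where
  "past n = vimage_algebra (space M) (\<lambda>\<omega>. \<lambda>k\<in>{1..n}. X k \<omega>) (PiM {1..n} (\<lambda>_. borel))"

lemma space_past [simp]: "space (past n) = space M"
  by (simp add: past_def)

lemma X_past: "1 \<le> k \<Longrightarrow> k \<le> n \<Longrightarrow> X k \<in> borel_measurable (past n)"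
proof -
  assume k: "1 \<le> k" "k \<le> n"
  let ?f = "\<lambda>\<omega>. \<lambda>k\<in>{1..n}. X k \<omega>"
  have "?f \<in> measurable (past n) (PiM {1..n} (\<lambda>_. borel))"
    unfolding past_def by (rule measurable_vimage_algebra1) (auto simp: space_PiM)
  then have "(\<lambda>\<omega>. ?f \<omega> k) \<in> borel_measurable (past n)"
    by (rule measurable_compose[OF _ measurable_component_singleton]) (use k in auto)
  then show ?thesis using k by simp
qed

lemma sign_step_past: "1 \<le> k \<Longrightarrow> k \<le> n \<Longrightarrow> sign_step k \<in> borel_measurable (past n)"
  using X_past[of k n] unfolding sign_step_def[abs_def] by measurable

lemma subalgebra_past: "subalgebra M (past n)"
proof -
  have "(\<lambda>\<omega>. \<lambda>k\<in>{1..n}. X k \<omega>) \<in> measurable M (PiM {1..n} (\<lambda>_. borel))"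
    by (rule measurable_restrict) (use X_measurable in auto)
  then have "sets (past n) \<subseteq> sets M"
    unfolding past_def by (intro sets_image_in_sets) auto
  then show ?thesis by (simp add: subalgebra_def)
qed

lemma choice_measurable:
  "1 \<le> n \<Longrightarrow> (\<lambda>\<omega>. (K n \<omega>, R n \<omega>)) \<in> measurable M (count_space UNIV)"
  using measurable_Pair[OF K_measurable R_measurable, of n n]
  by (simp add: pair_measure_countable)

lemma prob_choice:
  assumes "1 \<le> n" "j \<in> {1..n}"
  shows "prob {\<omega> \<in> space M. K n \<omega> = j \<and> R n \<omega> = r} = (if r then p else 1 - p) / real n"
proof -
  have "prob {\<omega> \<in> space M. K n \<omega> = j \<and> R n \<omega> = r} =
      measure (distr M (count_space UNIV) (\<lambda>\<omega>. (K n \<omega>, R n \<omega>))) {(j, r)}"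
    by (subst measure_distr) (auto intro!: arg_cong[where f = prob] choice_measurable assms)
  also have "\<dots> = pmf (pair_pmf (pmf_of_set {1..n}) (bernoulli_pmf p)) (j, r)"
    unfolding choice_distr[OF assms(1)] by (simp add: pmf.rep_eq)
  also have "\<dots> = (if r then p else 1 - p) / real n"
    using assms p_range by (cases r) (auto simp: pmf_pair pmf_of_set)
  finally show ?thesis .
qed

lemma AE_choice_range: assumes "1 \<le> n" shows "AE \<omega> in M. K n \<omega> \<in> {1..n}"
proof -
  have "AE x in distr M (count_space UNIV) (\<lambda>\<omega>. (K n \<omega>, R n \<omega>)). fst x \<in> {1..n}"
    unfolding choice_distr[OF assms] using assms by (auto intro!: AE_pmfI simp: set_pmf_of_set)
  from AE_distrD[OF choice_measurable[OF assms] this] show ?thesis by simp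
qed

lemma AE_first_step: "AE \<omega> in M. X 1 \<omega> = sign_step 1 \<omega>"
proof -
  have [measurable]: "X 1 \<in> borel_measurable M" using X_measurable by simp
  let ?A = "{\<omega> \<in> space M. X 1 \<omega> = 1}" and ?B = "{\<omega> \<in> space M. X 1 \<omega> = -1}"
  have AB: "?A \<in> events" "?B \<in> events" by measurable
  then have "prob (?A \<union> ?B) = prob ?A + prob ?B"
    by (intro finite_measure_Union) auto
  also have "\<dots> = 1" unfolding first_step_pos first_step_neg by simp
  finally have "AE \<omega> in M. \<omega> \<in> ?A \<union> ?B" using AB by (subst (asm) prob_eq_1) auto
  then show ?thesis by eventually_elim (auto simp: sign_step_def)
qed

text \<open>Strong induction, since the recalled step may be any earlier one; almost surely its
  index lies in \<open>{1..m}\<close>, and copying or reversing preserves the values 1 and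
  -1.\<close>

lemma AE_sign_step: "1 \<le> n \<Longrightarrow> AE \<omega> in M. X n \<omega> = sign_step n \<omega>"
proof (induction n rule: less_induct)
  case (less n)
  show ?case
  proof (cases "n = 1")
    case True
    then show ?thesis using AE_first_step by simp
  next
    case False
    then obtain m where m: "n = Suc m" "1 \<le> m" using less.prems by (cases n) auto
    have "AE \<omega> in M. \<forall>k\<in>{1..m}. X k \<omega> = sign_step k \<omega>"
      using less.IH m by (intro AE_finite_allI) auto
    with next_step[OF m(2)] AE_choice_range[OF m(2)] show ?thesis
      by eventually_elim (auto simp: sign_step_def m split: if_splits)
  qed
qed

text \<open>Decomposition by the recalled index \<open>j\<close> and the repeat flag. Each such
  event is independent of the past and has probability \<open>p / n\<close> or
  \<open>(1 - p) / n\<close>; the two signs leave the weight \<open>(2 * p - 1) / n\<close> for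
  every \<open>j\<close>.\<close>

lemma sign_step_mean:
  assumes n: "1 \<le> n" and g: "bdd_measurable (past n) g"
  shows "expectation (\<lambda>\<omega>. g \<omega> * sign_step (Suc n) \<omega>) =
    (2 * p - 1) * expectation (\<lambda>\<omega>. g \<omega> * (erw_position sign_step n \<omega> / real n))"
proof -
  let ?I = "\<lambda>j r \<omega>. indicator {\<omega> \<in> space M. K n \<omega> = j \<and> R n \<omega> = r} \<omega> :: real"
  let ?G = "\<lambda>j \<omega>. g \<omega> * sign_step j \<omega>"
  let ?H = "vimage_algebra (space M) (\<lambda>\<omega>. (K n \<omega>, R n \<omega>)) (count_space UNIV)"
  have G: "bdd_measurable (past n) (?G j)" if "j \<in> {1..n}" for j
    using that by (intro bdd_measurable_mult g bdd_measurableI[of _ _ 1] sign_step_past)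
      (auto simp: sign_step_def)
  have int_G: "integrable M (?G j)" if "j \<in> {1..n}" for j
    using G[OF that] bdd_measurable_subalgebra[OF subalgebra_past] bdd_measurable_integrable by blast
  have event: "{\<omega> \<in> space M. K n \<omega> = j \<and> R n \<omega> = r} \<in> events" for j r
  proof -
    have "{\<omega> \<in> space M. K n \<omega> = j \<and> R n \<omega> = r} = (\<lambda>\<omega>. (K n \<omega>, R n \<omega>)) -` {(j, r)} \<inter> space M" by auto
    also have "\<dots> \<in> events" by (rule measurable_sets[OF choice_measurable[OF n]]) simp
    finally show ?thesis .
  qed
  have I_H: "?I j r \<in> borel_measurable ?H" for j r
  proof (rule borel_measurable_indicator)
    have "{\<omega> \<in> space M. K n \<omega> = j \<and> R n \<omega> = r} = (\<lambda>\<omega>. (K n \<omega>, R n \<omega>)) -` {(j, r)} \<inter> space M" by auto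
    also have "\<dots> \<in> sets ?H" by (rule in_vimage_algebra) simp
    finally show "{\<omega> \<in> space M. K n \<omega> = j \<and> R n \<omega> = r} \<in> sets ?H" .
  qed
  have int_I: "integrable M (?I j r)" for j r
    using event by (intro integrable_real_indicator) (auto simp: less_top[symmetric])
  have prod: "expectation (\<lambda>\<omega>. ?G j \<omega> * ?I j r \<omega>) = expectation (?G j) * ((if r then p else 1 - p) / real n)"
    if j: "j \<in> {1..n}" for j r
  proof -
    have "expectation (\<lambda>\<omega>. ?G j \<omega> * ?I j r \<omega>) = expectation (?G j) * expectation (?I j r)"
      using G[OF j] I_H int_G[OF j] int_I choice_indep[OF n]
      by (intro expectation_mult_indep_set[of "past n" ?H]) (auto simp: bdd_measurable_def past_def)
    also have "expectation (?I j r) = prob {\<omega> \<in> space M. K n \<omega> = j \<and> R n \<omega> = r}"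
      using event by (simp add: Int_absorb2 subset_iff)
    finally show ?thesis using prob_choice[OF n j] by simp
  qed
  have int_prod: "integrable M (\<lambda>\<omega>. ?G j \<omega> * ?I j r \<omega>)" if "j \<in> {1..n}" for j r
    using int_G[OF that] event by (intro integrable_real_mult_indicator) auto
  have sign_M [measurable]: "sign_step k \<in> borel_measurable M" if "1 \<le> k" for k
    using sign_step_past[of k k] that measurable_from_subalg[OF subalgebra_past] by blast
  have g_M [measurable]: "g \<in> borel_measurable M"
    using g measurable_from_subalg[OF subalgebra_past] by (auto simp: bdd_measurable_def)
  have "expectation (\<lambda>\<omega>. g \<omega> * sign_step (Suc n) \<omega>) =
      expectation (\<lambda>\<omega>. \<Sum>j=1..n. ?G j \<omega> * ?I j True \<omega> - ?G j \<omega> * ?I j False \<omega>)"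
  proof (rule integral_cong_AE)
    show "(\<lambda>\<omega>. g \<omega> * sign_step (Suc n) \<omega>) \<in> borel_measurable M"
      by (intro borel_measurable_times g_M sign_M) simp
    show "(\<lambda>\<omega>. \<Sum>j=1..n. ?G j \<omega> * ?I j True \<omega> - ?G j \<omega> * ?I j False \<omega>) \<in> borel_measurable M"
      using int_prod by (intro borel_measurable_sum borel_measurable_diff borel_measurable_integrable)
    have "AE \<omega> in M. \<forall>k\<in>{1..Suc n}. X k \<omega> = sign_step k \<omega>"
      by (intro AE_finite_allI AE_sign_step) auto
    with next_step[OF n] AE_choice_range[OF n] AE_space
    show "AE \<omega> in M. g \<omega> * sign_step (Suc n) \<omega> = (\<Sum>j=1..n. ?G j \<omega> * ?I j True \<omega> - ?G j \<omega> * ?I j False \<omega>)"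
    proof eventually_elim
      case (elim \<omega>)
      \<comment> \<open>At a given point only \<open>j = K n\<close> contributes, through exactly
        one of the two indicators, and the flag decides the sign.\<close>
      have "(\<Sum>j=1..n. ?G j \<omega> * ?I j True \<omega> - ?G j \<omega> * ?I j False \<omega>) =
          (\<Sum>j=1..n. if K n \<omega> = j then (if R n \<omega> then ?G j \<omega> else - ?G j \<omega>) else 0)"
        using elim by (intro sum.cong refl) (auto simp: indicator_def)
      also have "\<dots> = (if R n \<omega> then ?G (K n \<omega>) \<omega> else - ?G (K n \<omega>) \<omega>)"
        using elim by (subst sum.delta') auto
      also have "\<dots> = g \<omega> * sign_step (Suc n) \<omega>"
      proof -
        have "sign_step (Suc n) \<omega> = X (Suc n) \<omega>" "sign_step (K n \<omega>) \<omega> = X (K n \<omega>) \<omega>"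
          using elim by auto
        then show ?thesis using elim(1) by simp
      qed
      finally show ?case by simp
    qed
  qed
  also have "\<dots> = (\<Sum>j=1..n. expectation (\<lambda>\<omega>. ?G j \<omega> * ?I j True \<omega>) - expectation (\<lambda>\<omega>. ?G j \<omega> * ?I j False \<omega>))"
    by (subst Bochner_Integration.integral_sum, intro Bochner_Integration.integrable_diff int_prod, assumption+)
      (intro sum.cong refl Bochner_Integration.integral_diff int_prod, assumption+)
  also have "\<dots> = (\<Sum>j=1..n. (2 * p - 1) / real n * expectation (?G j))"
    by (intro sum.cong refl, simp only: prod) (simp add: field_simps)
  also have "\<dots> = (2 * p - 1) / real n * expectation (\<lambda>\<omega>. \<Sum>j=1..n. ?G j \<omega>)"
    using int_G by (subst Bochner_Integration.integral_sum) (auto simp: sum_distrib_left)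
  also have "(\<lambda>\<omega>. \<Sum>j=1..n. ?G j \<omega>) = (\<lambda>\<omega>. g \<omega> * erw_position sign_step n \<omega>)"
    by (simp add: erw_position_def sum_distrib_left)
  finally show ?thesis by simp
qed

lemma erw_martingale_sign_step:
  assumes "p < 3 / 4"
  shows "erw_martingale M past sign_step (2 * p - 1)"
proof
  show "-1 \<le> 2 * p - 1" "2 * p - 1 < 1 / 2" using assms p_range by auto
  show "sign_step k \<omega> = 1 \<or> sign_step k \<omega> = -1" for k \<omega> by (simp add: sign_step_def)
qed (fact subalgebra_past sign_step_past sign_step_mean)+

end

lemma erw_confidence_interval_cong:
  assumes "\<And>k. 1 \<le> k \<Longrightarrow> k \<le> n \<Longrightarrow> X k \<omega> = X' k \<omega>"
  shows "erw_confidence_interval X \<alpha> n \<omega> = erw_confidence_interval X' \<alpha> n \<omega>"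
proof -
  have S: "erw_position X k \<omega> = erw_position X' k \<omega>" if "k \<le> n" for k
    unfolding erw_position_def using assms that by (intro sum.cong) auto
  have X: "X (k + 1) \<omega> = X' (k + 1) \<omega>" if "k \<in> {1..n-1}" for k
    using assms[of "k + 1"] that by auto
  have "erw_estimator X n \<omega> = erw_estimator X' n \<omega>"
    unfolding erw_estimator_def
    by (intro arg_cong2[where f = "(/)"] arg_cong2[where f = "(*)"] sum.cong refl) (use S X in auto)
  then show ?thesis
    by (simp add: erw_confidence_interval_def erw_half_width_def)
qed

theorem theorem3p4:
  fixes M :: "'a measure"
    and p q \<alpha> :: real
    and X :: "nat \<Rightarrow> 'a \<Rightarrow> real"
    and K :: "nat \<Rightarrow> 'a \<Rightarrow> nat"
    and R :: "nat \<Rightarrow> 'a \<Rightarrow> bool"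
  assumes "elephant_random_walk M p q X K R"
    and "p < 3 / 4"
    and "0 < \<alpha>" and "\<alpha> < 1"
  shows "(\<lambda>n. measure M {\<omega> \<in> space M. p \<in> erw_confidence_interval X \<alpha> n \<omega>})
           \<longlonglongrightarrow> 1 - \<alpha>"
proof -
  interpret elephant_random_walk M p q X K R by fact
  interpret sgn: erw_martingale M past sign_step "2 * p - 1"
    by (rule erw_martingale_sign_step) fact
  \<comment> \<open>The interval at time \<open>n\<close> depends on the first \<open>n\<close>
    steps only, so finitely many almost sure equalities identify the two events up to a null
    set.\<close>
  have "prob {\<omega> \<in> space M. p \<in> erw_confidence_interval X \<alpha> n \<omega>} =
      prob {\<omega> \<in> space M. p \<in> erw_confidence_interval sign_step \<alpha> n \<omega>}" for n
  proof (rule finite_measure_eq_AE)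
    have "AE \<omega> in M. \<forall>k\<in>{1..n}. X k \<omega> = sign_step k \<omega>"
      by (intro AE_finite_allI AE_sign_step) auto
    then show "AE \<omega> in M. \<omega> \<in> {\<omega> \<in> space M. p \<in> erw_confidence_interval X \<alpha> n \<omega>} \<longleftrightarrow>
        \<omega> \<in> {\<omega> \<in> space M. p \<in> erw_confidence_interval sign_step \<alpha> n \<omega>}"
      by eventually_elim (use erw_confidence_interval_cong[of n X _ sign_step \<alpha>] in auto)
    show "{\<omega> \<in> space M. p \<in> erw_confidence_interval X \<alpha> n \<omega>} \<in> events"
      by (rule erw_coverage_event) (rule X_measurable)
    show "{\<omega> \<in> space M. p \<in> erw_confidence_interval sign_step \<alpha> n \<omega>} \<in> events"
      by (rule erw_coverage_event)
        (rule measurable_from_subalg[OF subalgebra_past sign_step_past[OF _ order_refl]])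
  qed
  then show ?thesis
    using sgn.confidence_interval_coverage[OF refl] assms(3,4) by simp
qed

end
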